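(* Let $n\ge 1$, let $\mathfrak g=\mathfrak p(n)$ be the periplectic Lie superalgebra over $\mathbb C$ with the choice of positive odd roots $\Delta^+_{\bar 1}=\Delta(\mathfrak g_{-1})=\{-(\varepsilon_i+\varepsilon_j):1\le i<j\le n\}$ and positive even roots $\Delta^+_{\bar 0}=\{\varepsilon_i-\varepsilon_j:1\le i<j\le n\}$. Let $\rho=\sum_{i=1}^n (n-i)\varepsilon_i$ and $$R=\frac{\prod_{1\le i<j\le n}\left(1-e^{-(\varepsilon_i-\varepsilon_j)}\right)}{\prod_{1\le i<j\le n}\left(1-e^{\varepsilon_i+\varepsilon_j}\right)}.$$ Let $r=\lfloor n/2\rfloor$, let $\beta_i=-(\varepsilon_{2i-1}+\varepsilon_{2i})$ for $1\le i\le r$, let $S=\{\beta_1,\ldots,\beta_r\}$, and let $$\rho^{\Uparrow}=\rho+(n-2)\beta_1+(n-4)\beta_2+\cdots+(n-2r)\beta_r=\varepsilon_1+\varepsilon_3+\cdots+\varepsilon_{2r-1}.$$ Then $$e^{\rho}R=\frac{1}{r!}\sum_{w\in W}(\operatorname{sgn} w)\, w\left(\frac{e^{\rho^{\Uparrow}}}{\prod_{\beta\in S}\left(1-e^{-\beta}\right)}\right).$$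
   Context: The periplectic Lie superalgebra $\mathfrak p(n)$ is the Lie superalgebra of all endomorphisms $X$ of an $(n|n)$-dimensional complex superspace $V$ preserving a non-degenerate odd symmetric bilinear form $\beta$ on $V$ (that is, $\beta(Xv,w)+(-1)^{\bar X\bar v}\beta(v,Xw)=0$); in a suitable basis its elements are the matrices $\begin{pmatrix}A&B\\ C&-A^t\end{pmatrix}$ with $A,B,C$ complex $n\times n$ matrices, $B^t=B$, $C^t=-C$. The Cartan subalgebra $\mathfrak h$ is the set of diagonal matrices in it, and $\varepsilon_1,\ldots,\varepsilon_n$ is the standard basis of $\mathfrak h^*$. The root set is $\Delta=\Delta(\mathfrak g_{-1})\cup\Delta(\mathfrak g_0)\cup\Delta(\mathfrak g_1)$, with even roots $\Delta(\mathfrak g_0)=\{\varepsilon_i-\varepsilon_j: i\neq j\}$ and odd roots $\Delta(\mathfrak g_1)=\{\varepsilon_i+\varepsilon_j:1\le i\le j\le n\}$, $\Delta(\mathfrak g_{-1})=\{-(\varepsilon_i+\varepsilon_j):1\le i<j\le n\}$. For a choice of positive roots, $\rho=\rho_{\bar 0}-\rho_{\bar 1}$, where $\rho_{\bar 0}$ and $\rho_{\bar 1}$ are the half-sums of the positive even and positive odd roots; here this equals $\sum_{i=1}^n(n-i)\varepsilon_i$. The denominator is $R=\prod_{\alpha\in\Delta^+_{\bar 0}}(1-e^{-\alpha})\big/\prod_{\alpha\in\Delta^+_{\bar 1}}(1-e^{-\alpha})$. The identity is in the rational function field generated by the formal exponentials $e^\lambda$, $\lambda\in\mathfrak h^*$,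 with $e^\lambda e^\mu=e^{\lambda+\mu}$, $e^0=1$. The Weyl group is $W=S_n$, acting on $\mathfrak h^*$ by $w(\varepsilon_i)=\varepsilon_{w(i)}$ and by field automorphisms $w(e^\lambda)=e^{w\lambda}$; $\operatorname{sgn} w$ is the sign of the permutation $w$. Empty sums are $0$ and empty products are $1$. *)

theory Defs
  imports
    "HOL-Library.Poly_Mapping"
    "HOL-Computational_Algebra.Fraction_Field"
    "HOL-Combinatorics.Permutations"
    "Jordan_Normal_Form.Matrix"
begin

section \<open>Weights\<close>

text \<open>
  A weight is a finitely supported family of complex coordinates with respect to the basis
  \<open>\<epsilon> 1, \<epsilon> 2, \<dots>\<close>. The dual of the Cartan subalgebra of \<open>\<pp>(n)\<close> is the subspace
  \<open>weight_space n\<close> of the weights supported on \<open>{1..n}\<close>; in this way one field of formal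
  exponentials contains those of all ranks. The index 0 is not used.
  It is a type of its own, rather than \<open>nat \<Rightarrow>\<^sub>0 complex\<close>, because it needs an auxiliary
  linear order.
\<close>

typedef weight = "{f :: nat \<Rightarrow> complex. finite {i. f i \<noteq> 0}}"
  morphisms coord Abs_weight
  by (rule exI[of _ "\<lambda>_. 0"]) simp

setup_lifting type_definition_weight

lemma weight_eqI: "(\<And>i. coord x i = coord y i) \<Longrightarrow> x = y"
  by (metis coord_inject ext)

lemma finite_coord: "finite {i. coord x i \<noteq> 0}"
  using coord[of x] by simp

instantiation weight :: ab_group_add
begin
lift_definition zero_weight :: weight is "\<lambda>_. 0" by simp
lift_definition plus_weight :: "weight \<Rightarrow> weight \<Rightarrow> weight" is "\<lambda>f g i. f i + g i"
proof -
  fix f g :: "nat \<Rightarrow> complex"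
  assume "finite {i. f i \<noteq> 0}" "finite {i. g i \<noteq> 0}"
  then show "finite {i. f i + g i \<noteq> 0}"
    by (rule finite_subset[rotated, OF finite_UnI]) auto
qed
lift_definition uminus_weight :: "weight \<Rightarrow> weight" is "\<lambda>f i. - f i" by simp
definition minus_weight :: "weight \<Rightarrow> weight \<Rightarrow> weight" where "minus_weight x y = x + (- y)"
instance
  by standard (auto simp: minus_weight_def algebra_simps, (transfer; simp add: algebra_simps)+)
end

lift_definition \<epsilon> :: "nat \<Rightarrow> weight" is "\<lambda>i j. if j = i then 1 else 0" by simp

lift_definition scale :: "complex \<Rightarrow> weight \<Rightarrow> weight" (infixr \<open>*\<^sub>w\<close> 75) is "\<lambda>c f i. c * f i"
  by (erule rev_finite_subset) auto

lemma coord_simps [simp]: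
  "coord 0 i = 0" "coord (x + y) i = coord x i + coord y i" "coord (- x) i = - coord x i"
  "coord (x - y) i = coord x i - coord y i" "coord (\<epsilon> j) i = (if i = j then 1 else 0)"
  "coord (c *\<^sub>w x) i = c * coord x i"
  unfolding minus_weight_def by (transfer; simp)+

lemma coord_sum [simp]: "coord (sum f A) i = (\<Sum>a\<in>A. coord (f a) i)"
  by (induction A rule: infinite_finite_induct) auto

text \<open>
  An auxiliary translation-invariant linear order (lexicographic in the coordinates and their
  real and imaginary parts). Its only purpose is the instance \<open>idom\<close> of the group algebra,
  which the library proves for linearly ordered exponents.
\<close>

definition coord_less :: "complex \<Rightarrow> complex \<Rightarrow> bool" where
  "coord_less a b \<longleftrightarrow> Re a < Re b \<or> Re a = Re b \<and> Im a < Im b"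

instantiation weight :: linorder
begin
definition less_weight :: "weight \<Rightarrow> weight \<Rightarrow> bool" where
  "less_weight x y \<longleftrightarrow> (\<exists>k. (\<forall>i<k. coord x i = coord y i) \<and> coord_less (coord x k) (coord y k))"
definition less_eq_weight :: "weight \<Rightarrow> weight \<Rightarrow> bool" where
  "less_eq_weight x y \<longleftrightarrow> x = y \<or> x < y"
instance
proof
  have irrefl: "\<not> x < x" for x :: weight
    by (auto simp: less_weight_def coord_less_def)
  have trans: "x < z" if xy: "x < y" and yz: "y < z" for x y z :: weight
  proof -
    obtain k where k: "\<forall>i<k. coord x i = coord y i" "coord_less (coord x k) (coord y k)"
      using xy by (auto simp: less_weight_def)
    obtain l where l: "\<forall>i<l. coord y i = coord z i" "coord_less (coord y l) (coord z l)"
      using yz by (auto simp: less_weight_def)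
    have "coord_less (coord x (min k l)) (coord z (min k l))"
      using k l by (cases k l rule: linorder_cases) (auto simp: coord_less_def min_def)
    moreover have "\<forall>i<min k l. coord x i = coord z i"
      using k l by simp
    ultimately show ?thesis
      unfolding less_weight_def by blast
  qed
  have total: "x < y \<or> x = y \<or> y < x" for x y :: weight
  proof (cases "x = y")
    case False
    then have ex: "\<exists>i. coord x i \<noteq> coord y i"
      using weight_eqI by blast
    define k where "k = (LEAST i. coord x i \<noteq> coord y i)"
    have "coord x k \<noteq> coord y k"
      unfolding k_def by (rule LeastI_ex[OF ex])
    moreover have "\<forall>i<k. coord x i = coord y i"
      unfolding k_def using not_less_Least by blast
    ultimately have "x < y \<or> y < x"
      unfolding less_weight_def coord_less_def by (metis complex_eqI linorder_neqE_linordered_idom)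
    then show ?thesis by blast
  qed simp
  fix x y z :: weight
  show "x < y \<longleftrightarrow> x \<le> y \<and> \<not> y \<le> x"
    using irrefl trans unfolding less_eq_weight_def by metis
  show "x \<le> x"
    by (simp add: less_eq_weight_def)
  show "x \<le> z" if "x \<le> y" "y \<le> z"
    using trans that unfolding less_eq_weight_def by metis
  show "x = y" if "x \<le> y" "y \<le> x"
    using irrefl trans that unfolding less_eq_weight_def by metis
  show "x \<le> y \<or> y \<le> x"
    using total[of x y] unfolding less_eq_weight_def by metis
qed
end

instance weight :: ordered_cancel_comm_monoid_add
proof
  fix a b c :: weight
  assume "a \<le> b"
  then show "c + a \<le> c + b"
    by (auto simp: less_eq_weight_def less_weight_def coord_less_def)
qed

definition weight_space :: "nat \<Rightarrow> weight set" where
  "weight_space n = {x. \<forall>i. coord x i \<noteq> 0 \<longrightarrow> i \<in> {1..n}}"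


section \<open>Formal exponentials and the Weyl group action\<close>

type_synonym group_algebra = "weight \<Rightarrow>\<^sub>0 complex"
type_synonym exp_field = "group_algebra fract"

definition fexp :: "weight \<Rightarrow> exp_field" where
  "fexp x = Fraction_Field.Fract (Poly_Mapping.single x 1) 1"

lemma fexp_0: "fexp 0 = 1"
  by (simp add: fexp_def One_fract_def)

lemma fexp_add: "fexp (x + y) = fexp x * fexp y"
  by (simp add: fexp_def mult_single)

text \<open>The linear extension to weights, and then to the group algebra and its fraction field,
  of \<open>\<epsilon> i \<mapsto> \<epsilon> (w i)\<close>.\<close>

definition weight_act :: "(nat \<Rightarrow> nat) \<Rightarrow> weight \<Rightarrow> weight" where
  "weight_act w x = (\<Sum>i | coord x i \<noteq> 0. coord x i *\<^sub>w \<epsilon> (w i))"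

definition algebra_act :: "(nat \<Rightarrow> nat) \<Rightarrow> group_algebra \<Rightarrow> group_algebra" where
  "algebra_act w a =
     (\<Sum>x\<in>Poly_Mapping.keys a. Poly_Mapping.single (weight_act w x) (Poly_Mapping.lookup a x))"

text \<open>For injective \<open>w\<close> the value does not depend on the chosen fraction; see \<open>weyl_act_Fract\<close>.\<close>

definition weyl_act :: "(nat \<Rightarrow> nat) \<Rightarrow> exp_field \<Rightarrow> exp_field" where
  "weyl_act w q =
     (THE y. \<exists>a b. b \<noteq> 0 \<and> q = Fraction_Field.Fract a b \<and>
        y = Fraction_Field.Fract (algebra_act w a) (algebra_act w b))"

lemma weight_act_superset:
  assumes "finite A" "{i. coord x i \<noteq> 0} \<subseteq> A"
  shows "weight_act w x = (\<Sum>i\<in>A. coord x i *\<^sub>w \<epsilon> (w i))"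
  unfolding weight_act_def using assms
  by (intro sum.mono_neutral_left) (auto intro!: weight_eqI)

lemma weight_act_eps [simp]: "weight_act w (\<epsilon> i) = \<epsilon> (w i)"
  by (subst weight_act_superset[of "{i}"]) (auto intro!: weight_eqI split: if_splits)

lemma weight_act_add: "weight_act w (x + y) = weight_act w x + weight_act w y"
proof -
  let ?A = "{i. coord x i \<noteq> 0} \<union> {i. coord y i \<noteq> 0}"
  have fin: "finite ?A"
    by (simp add: finite_coord)
  show ?thesis
    by (subst (1 2 3) weight_act_superset[OF fin])
       (auto intro!: weight_eqI simp: sum.distrib[symmetric] algebra_simps)
qed

lemma weight_act_0 [simp]: "weight_act w 0 = 0"
  by (simp add: weight_act_def)

lemma weight_act_scale: "weight_act w (c *\<^sub>w x) = c *\<^sub>w weight_act w x"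
  by (subst (1 2) weight_act_superset[OF finite_coord[of x]])
     (auto intro!: weight_eqI simp: sum_distrib_left mult.assoc)

lemma coord_weight_act:
  assumes "inj w"
  shows "coord (weight_act w x) (w i) = coord x i"
proof -
  have "coord (weight_act w x) (w i) = (\<Sum>j | coord x j \<noteq> 0. if j = i then coord x j else 0)"
    unfolding weight_act_def coord_sum using injD[OF assms]
    by (intro sum.cong) auto
  also have "\<dots> = coord x i"
    by (simp add: sum.delta[OF finite_coord])
  finally show ?thesis .
qed

lemma inj_weight_act: "inj w \<Longrightarrow> inj (weight_act w)"
  by (rule injI) (metis coord_weight_act weight_eqI)

lemma algebra_act_superset:
  assumes "finite A" "Poly_Mapping.keys a \<subseteq> A"
  shows "algebra_act w a =
    (\<Sum>x\<in>A. Poly_Mapping.single (weight_act w x) (Poly_Mapping.lookup a x))"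
  unfolding algebra_act_def using assms
  by (intro sum.mono_neutral_left) (auto simp: in_keys_iff)

lemma algebra_act_single [simp]:
  "algebra_act w (Poly_Mapping.single x c) = Poly_Mapping.single (weight_act w x) c"
  by (subst algebra_act_superset[of "{x}"]) auto

lemma algebra_act_0 [simp]: "algebra_act w 0 = 0"
  by (simp add: algebra_act_def)

lemma algebra_act_add: "algebra_act w (a + b) = algebra_act w a + algebra_act w b"
proof -
  let ?A = "Poly_Mapping.keys a \<union> Poly_Mapping.keys b"
  have fin: "finite ?A" by simp
  show ?thesis
    by (subst (1 2 3) algebra_act_superset[OF fin])
       (auto simp: sum.distrib[symmetric] lookup_add single_add dest: subsetD[OF keys_add])
qed

lemma algebra_act_sum: "algebra_act w (sum f A) = (\<Sum>x\<in>A. algebra_act w (f x))"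
  by (induction A rule: infinite_finite_induct) (auto simp: algebra_act_add)

lemma group_algebra_expand:
  fixes a :: group_algebra
  shows "a = (\<Sum>x\<in>Poly_Mapping.keys a. Poly_Mapping.single x (Poly_Mapping.lookup a x))"
  by (rule poly_mapping_eqI)
     (auto simp: lookup_sum lookup_single when_def in_keys_iff sum.delta)

lemma algebra_act_mult: "algebra_act w (a * b) = algebra_act w a * algebra_act w b"
proof -
  let ?s = Poly_Mapping.single and ?l = Poly_Mapping.lookup and ?k = Poly_Mapping.keys
  have "a * b = (\<Sum>x\<in>?k a. ?s x (?l a x)) * (\<Sum>y\<in>?k b. ?s y (?l b y))"
    using group_algebra_expand by metis
  also have "\<dots> = (\<Sum>x\<in>?k a. \<Sum>y\<in>?k b. ?s (x + y) (?l a x * ?l b y))"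
    by (simp add: sum_product mult_single)
  finally have "algebra_act w (a * b) =
      (\<Sum>x\<in>?k a. \<Sum>y\<in>?k b. ?s (weight_act w x + weight_act w y) (?l a x * ?l b y))"
    by (simp add: algebra_act_sum weight_act_add)
  also have "\<dots> = algebra_act w a * algebra_act w b"
    by (simp add: algebra_act_def sum_product mult_single)
  finally show ?thesis .
qed

lemma algebra_act_1 [simp]: "algebra_act w 1 = 1"
  by (metis algebra_act_single single_one weight_act_0)

lemma lookup_algebra_act:
  assumes "inj w"
  shows "Poly_Mapping.lookup (algebra_act w a) (weight_act w x) = Poly_Mapping.lookup a x"
  using inj_weight_act[OF assms]
  by (auto simp: algebra_act_def lookup_sum lookup_single when_def inj_eq in_keys_iff sum.delta)

lemma algebra_act_eq_0_iff: "inj w \<Longrightarrow> algebra_act w a = 0 \<longleftrightarrow> a = 0"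
  by (metis algebra_act_0 lookup_algebra_act lookup_zero poly_mapping_eqI)

lemma weyl_act_Fract:
  assumes "inj w" "b \<noteq> 0"
  shows "weyl_act w (Fraction_Field.Fract a b) =
    Fraction_Field.Fract (algebra_act w a) (algebra_act w b)"
  unfolding weyl_act_def
proof (rule the_equality)
  show "\<exists>a' b'. b' \<noteq> 0 \<and> Fraction_Field.Fract a b = Fraction_Field.Fract a' b' \<and>
      Fraction_Field.Fract (algebra_act w a) (algebra_act w b) =
      Fraction_Field.Fract (algebra_act w a') (algebra_act w b')"
    using assms by blast
next
  fix y
  assume "\<exists>a' b'. b' \<noteq> 0 \<and> Fraction_Field.Fract a b = Fraction_Field.Fract a' b' \<and>
    y = Fraction_Field.Fract (algebra_act w a') (algebra_act w b')"
  then obtain a' b' where *: "b' \<noteq> 0" "Fraction_Field.Fract a b = Fraction_Field.Fract a' b'"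
    "y = Fraction_Field.Fract (algebra_act w a') (algebra_act w b')" by blast
  have "a * b' = a' * b"
    using * assms by (simp add: eq_fract)
  then have "algebra_act w a * algebra_act w b' = algebra_act w a' * algebra_act w b"
    by (metis algebra_act_mult)
  then show "y = Fraction_Field.Fract (algebra_act w a) (algebra_act w b)"
    using * assms by (simp add: eq_fract algebra_act_eq_0_iff)
qed

lemma weyl_act_fexp [simp]: "inj w \<Longrightarrow> weyl_act w (fexp x) = fexp (weight_act w x)"
  by (simp add: fexp_def weyl_act_Fract)

lemma weyl_act_0: "inj w \<Longrightarrow> weyl_act w 0 = 0"
  and weyl_act_1: "inj w \<Longrightarrow> weyl_act w 1 = 1"
  by (simp_all add: Zero_fract_def One_fract_def weyl_act_Fract)

lemma weyl_act_add: "inj w \<Longrightarrow> weyl_act w (p + q) = weyl_act w p + weyl_act w q"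
  by (cases p; cases q)
     (simp add: weyl_act_Fract algebra_act_eq_0_iff algebra_act_add algebra_act_mult)

lemma weyl_act_mult: "inj w \<Longrightarrow> weyl_act w (p * q) = weyl_act w p * weyl_act w q"
  by (cases p; cases q)
     (simp add: weyl_act_Fract algebra_act_eq_0_iff algebra_act_mult)

lemma weyl_act_inverse: "inj w \<Longrightarrow> weyl_act w (inverse q) = inverse (weyl_act w q)"
proof (cases "q = 0")
  case False
  assume w: "inj w"
  have "weyl_act w q * weyl_act w (inverse q) = 1"
    using False w by (simp add: weyl_act_mult[symmetric] weyl_act_1)
  then show ?thesis
    by (metis inverse_unique)
qed (simp add: weyl_act_0)


section \<open>The periplectic Lie superalgebra and its roots\<close>

text \<open>
  Endomorphisms of the \<open>(n|n)\<close>-dimensional superspace are \<open>2n\<times>2n\<close> matrices whose rows and columns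
  \<open>0..<n\<close> are even and \<open>n..<2*n\<close> are odd. The block form below describes those preserving the
  odd symmetric form that pairs the basis vectors \<open>k\<close> and \<open>n + k\<close> to 1. The subspaces with suffix
  \<open>_0\<close>, \<open>_1\<close>, \<open>_m1\<close> are the components of degree 0, 1, -1 of its grading.
\<close>

definition periplectic :: "nat \<Rightarrow> complex mat set" where
  "periplectic n = {four_block_mat A B C (- A\<^sup>T) | A B C.
     A \<in> carrier_mat n n \<and> B \<in> carrier_mat n n \<and> C \<in> carrier_mat n n \<and> B\<^sup>T = B \<and> C\<^sup>T = - C}"

definition periplectic_0 :: "nat \<Rightarrow> complex mat set" where
  "periplectic_0 n = {four_block_mat A (0\<^sub>m n n) (0\<^sub>m n n) (- A\<^sup>T) | A. A \<in> carrier_mat n n}"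

definition periplectic_1 :: "nat \<Rightarrow> complex mat set" where
  "periplectic_1 n =
     {four_block_mat (0\<^sub>m n n) B (0\<^sub>m n n) (0\<^sub>m n n) | B. B \<in> carrier_mat n n \<and> B\<^sup>T = B}"

definition periplectic_m1 :: "nat \<Rightarrow> complex mat set" where
  "periplectic_m1 n =
     {four_block_mat (0\<^sub>m n n) (0\<^sub>m n n) C (0\<^sub>m n n) | C. C \<in> carrier_mat n n \<and> C\<^sup>T = - C}"

definition odd_part :: "nat \<Rightarrow> complex mat \<Rightarrow> complex mat" where
  "odd_part n X = mat (2 * n) (2 * n) (\<lambda>(p, q). if (p < n) = (q < n) then 0 else X $$ (p, q))"

text \<open>
  The bilinear extension of \<open>[X, Y] = X Y - (-1)\<^bsup>|X||Y|\<^esup> Y X\<close>: the sign differs from that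
  of the commutator only on the odd parts.
\<close>

definition super_bracket :: "nat \<Rightarrow> complex mat \<Rightarrow> complex mat \<Rightarrow> complex mat" where
  "super_bracket n X Y = X * Y - Y * X + 2 \<cdot>\<^sub>m (odd_part n Y * odd_part n X)"

definition cartan :: "nat \<Rightarrow> complex mat set" where
  "cartan n = {H \<in> periplectic n. diagonal_mat H}"

text \<open>The value at \<open>H\<close> in \<open>cartan n\<close> of a weight, where \<open>\<epsilon> i\<close> reads off the \<open>i\<close>-th diagonal entry.\<close>

definition weight_at :: "nat \<Rightarrow> weight \<Rightarrow> complex mat \<Rightarrow> complex" where
  "weight_at n x H = (\<Sum>i=1..n. coord x i * H $$ (i - 1, i - 1))"

definition roots_of :: "nat \<Rightarrow> complex mat set \<Rightarrow> weight set" where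
  "roots_of n V = {\<alpha> \<in> weight_space n. \<alpha> \<noteq> 0 \<and>
     (\<exists>X\<in>V. X \<noteq> 0\<^sub>m (2 * n) (2 * n) \<and>
       (\<forall>H\<in>cartan n. super_bracket n H X = weight_at n \<alpha> H \<cdot>\<^sub>m X))}"

definition pos_even_roots :: "nat \<Rightarrow> weight set" where
  "pos_even_roots n = {\<epsilon> i - \<epsilon> j | i j. 1 \<le> i \<and> i < j \<and> j \<le> n}"

definition pos_odd_roots :: "nat \<Rightarrow> weight set" where
  "pos_odd_roots n = roots_of n (periplectic_m1 n)"


section \<open>The denominator\<close>

text \<open>
  For the positive roots chosen above, the denominator is written out in lemma \<open>denominator_eq\<close>.
  The truncated subtractions below never truncate, and \<open>beta_set n\<close> has \<open>n div 2\<close> elements.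
\<close>

definition rho :: "nat \<Rightarrow> weight" where
  "rho n = (\<Sum>i=1..n. of_nat (n - i) *\<^sub>w \<epsilon> i)"

definition denominator :: "nat \<Rightarrow> exp_field" where
  "denominator n =
     (\<Prod>\<alpha>\<in>pos_even_roots n. 1 - fexp (- \<alpha>)) / (\<Prod>\<alpha>\<in>pos_odd_roots n. 1 - fexp (- \<alpha>))"

definition beta :: "nat \<Rightarrow> weight" where
  "beta i = - (\<epsilon> (2 * i - 1) + \<epsilon> (2 * i))"

definition beta_set :: "nat \<Rightarrow> weight set" where
  "beta_set n = beta ` {1..n div 2}"

definition rho_up :: "nat \<Rightarrow> weight" where
  "rho_up n = rho n + (\<Sum>i=1..n div 2. of_nat (n - 2 * i) *\<^sub>w beta i)"


section \<open>Explicit descriptions\<close>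

text \<open>The root vectors are supported on entries \<open>(p, q)\<close> with \<open>\<eta> n p - \<eta> n q\<close> equal to the root.\<close>

definition \<eta> :: "nat \<Rightarrow> nat \<Rightarrow> weight" where
  "\<eta> n p = (if p < n then \<epsilon> (Suc p) else - \<epsilon> (Suc (p - n)))"

definition torus :: "nat \<Rightarrow> (nat \<Rightarrow> complex) \<Rightarrow> complex mat" where
  "torus n a = mat (2 * n) (2 * n)
     (\<lambda>(p, q). if p \<noteq> q then 0 else if p < n then a (Suc p) else - a (Suc (p - n)))"

lemma cartan_eq: "cartan n = range (torus n)"
proof (intro equalityI subsetI)
  fix H assume "H \<in> cartan n"
  then obtain A B C where H: "H = four_block_mat A B C (- A\<^sup>T)" and d: "diagonal_mat H"
    and c: "A \<in> carrier_mat n n" "B \<in> carrier_mat n n" "C \<in> carrier_mat n n"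
    by (auto simp: cartan_def periplectic_def)
  have "H = torus n (\<lambda>i. A $$ (i - 1, i - 1))"
  proof (rule eq_matI)
    fix p q
    assume "p < dim_row (torus n (\<lambda>i. A $$ (i - 1, i - 1)))"
      "q < dim_col (torus n (\<lambda>i. A $$ (i - 1, i - 1)))"
    then have pq: "p < 2 * n" "q < 2 * n" by (auto simp: torus_def)
    show "H $$ (p, q) = torus n (\<lambda>i. A $$ (i - 1, i - 1)) $$ (p, q)"
    proof (cases "p = q")
      case False
      have "H $$ (p, q) = 0"
        using d pq False c by (auto simp: diagonal_mat_def H)
      then show ?thesis using False pq by (simp add: torus_def)
    next
      case True
      then show ?thesis using pq c by (auto simp: torus_def H)
    qed
  qed (use c in \<open>auto simp: H torus_def\<close>)
  then show "H \<in> range (torus n)" by blast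
next
  fix H assume "H \<in> range (torus n)"
  then obtain a where H: "H = torus n a" by blast
  let ?A = "mat n n (\<lambda>(p, q). if p = q then a (Suc p) else 0)"
  have "H = four_block_mat ?A (0\<^sub>m n n) (0\<^sub>m n n) (- ?A\<^sup>T)"
    by (rule eq_matI) (auto simp: H torus_def)
  moreover have "diagonal_mat H" by (auto simp: diagonal_mat_def H torus_def)
  ultimately show "H \<in> cartan n"
    unfolding cartan_def periplectic_def by force
qed

lemma weight_at_torus: "weight_at n x (torus n a) = (\<Sum>i=1..n. coord x i * a i)"
  unfolding weight_at_def
proof (rule sum.cong[OF refl])
  fix i assume "i \<in> {1..n}"
  then show "coord x i * torus n a $$ (i - 1, i - 1) = coord x i * a i"
    by (cases i) (auto simp: torus_def)
qed

lemma weight_at_eta: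
  assumes "p < 2 * n"
  shows "weight_at n (\<eta> n p) (torus n a) = torus n a $$ (p, p)"
proof -
  have "(\<Sum>i=1..n. coord (\<epsilon> k) i * a i) = a k" if "k \<in> {1..n}" for k
    using that by (simp add: if_distrib[of "\<lambda>x. x * _"] sum.delta cong: if_cong)
  moreover have "(\<Sum>i=1..n. coord (- \<epsilon> k) i * a i) = - (\<Sum>i=1..n. coord (\<epsilon> k) i * a i)" for k
    by (simp add: sum_negf[symmetric])
  ultimately show ?thesis
    using assms unfolding weight_at_torus by (auto simp: \<eta>_def torus_def)
qed

lemma weight_at_diff: "weight_at n (x - y) H = weight_at n x H - weight_at n y H"
  by (simp add: weight_at_def sum_subtractf algebra_simps)

lemma torus_mult:
  assumes "X \<in> carrier_mat (2 * n) (2 * n)" "p < 2 * n" "q < 2 * n"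
  shows "(torus n a * X) $$ (p, q) = torus n a $$ (p, p) * X $$ (p, q)"
    and "(X * torus n a) $$ (p, q) = X $$ (p, q) * torus n a $$ (q, q)"
proof -
  have "(torus n a * X) $$ (p, q) = (\<Sum>k = 0..<2 * n. torus n a $$ (p, k) * X $$ (k, q))"
    using assms by (simp add: torus_def scalar_prod_def)
  also have "\<dots> = (\<Sum>k = 0..<2 * n. if k = p then torus n a $$ (p, p) * X $$ (p, q) else 0)"
    using assms by (intro sum.cong) (auto simp: torus_def)
  finally show "(torus n a * X) $$ (p, q) = torus n a $$ (p, p) * X $$ (p, q)"
    using assms by simp
  have "(X * torus n a) $$ (p, q) = (\<Sum>k = 0..<2 * n. X $$ (p, k) * torus n a $$ (k, q))"
    using assms by (simp add: torus_def scalar_prod_def)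
  also have "\<dots> = (\<Sum>k = 0..<2 * n. if k = q then X $$ (p, q) * torus n a $$ (q, q) else 0)"
    using assms by (intro sum.cong) (auto simp: torus_def)
  finally show "(X * torus n a) $$ (p, q) = X $$ (p, q) * torus n a $$ (q, q)"
    using assms by simp
qed

lemma super_bracket_torus:
  assumes X: "X \<in> carrier_mat (2 * n) (2 * n)"
  shows "super_bracket n (torus n a) X =
    mat (2 * n) (2 * n) (\<lambda>(p, q). weight_at n (\<eta> n p - \<eta> n q) (torus n a) * X $$ (p, q))"
proof -
  have odd: "odd_part n (torus n a) = 0\<^sub>m (2 * n) (2 * n)"
    by (rule eq_matI) (auto simp: odd_part_def torus_def)
  have T: "torus n a \<in> carrier_mat (2 * n) (2 * n)"
    by (simp add: torus_def)
  have O: "odd_part n X \<in> carrier_mat (2 * n) (2 * n)"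
    by (simp add: odd_part_def)
  show ?thesis
    unfolding super_bracket_def odd
    by (rule eq_matI)
       (use X T O in \<open>auto simp del: index_mult_mat(1)
          simp: torus_mult weight_at_diff weight_at_eta algebra_simps right_mult_zero_mat[OF O]\<close>)
qed

lemma weight_at_inj:
  assumes "x \<in> weight_space n" "y \<in> weight_space n"
    and "\<And>a. weight_at n x (torus n a) = weight_at n y (torus n a)"
  shows "x = y"
proof (rule weight_eqI)
  fix i
  show "coord x i = coord y i"
  proof (cases "i \<in> {1..n}")
    case True
    have "weight_at n z (torus n (\<lambda>j. if j = i then 1 else 0)) = coord z i" for z
      using True by (simp add: weight_at_torus if_distrib[of "\<lambda>x. _ * x"] sum.delta cong: if_cong)
    then show ?thesis using assms(3) by metis
  next
    case False
    then show ?thesis using assms(1,2) unfolding weight_space_def by force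
  qed
qed

lemma eta_weight_space: "p < 2 * n \<Longrightarrow> q < 2 * n \<Longrightarrow> \<eta> n p - \<eta> n q \<in> weight_space n"
  by (auto simp: \<eta>_def weight_space_def split: if_splits)

lemma roots_of_eq:
  assumes "V \<subseteq> carrier_mat (2 * n) (2 * n)"
  shows "roots_of n V = {\<alpha>. \<alpha> \<noteq> 0 \<and> (\<exists>X\<in>V. X \<noteq> 0\<^sub>m (2 * n) (2 * n) \<and>
    (\<forall>p<2 * n. \<forall>q<2 * n. X $$ (p, q) \<noteq> 0 \<longrightarrow> \<alpha> = \<eta> n p - \<eta> n q))}" (is "_ = ?R")
proof (intro equalityI subsetI)
  fix \<alpha> assume "\<alpha> \<in> roots_of n V"
  then obtain X where \<alpha>: "\<alpha> \<in> weight_space n" "\<alpha> \<noteq> 0" and X: "X \<in> V" "X \<noteq> 0\<^sub>m (2 * n) (2 * n)"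
    and e: "\<And>a. super_bracket n (torus n a) X = weight_at n \<alpha> (torus n a) \<cdot>\<^sub>m X"
    unfolding roots_of_def cartan_eq by blast
  have c: "X \<in> carrier_mat (2 * n) (2 * n)" using X assms by blast
  have "\<alpha> = \<eta> n p - \<eta> n q" if pq: "p < 2 * n" "q < 2 * n" "X $$ (p, q) \<noteq> 0" for p q
  proof (rule weight_at_inj[OF \<alpha>(1) eta_weight_space[OF pq(1,2)]])
    fix a
    have "super_bracket n (torus n a) X $$ (p, q) = (weight_at n \<alpha> (torus n a) \<cdot>\<^sub>m X) $$ (p, q)"
      by (simp add: e)
    then show "weight_at n \<alpha> (torus n a) = weight_at n (\<eta> n p - \<eta> n q) (torus n a)"
      using pq c by (simp add: super_bracket_torus)
  qed
  then show "\<alpha> \<in> ?R" using \<alpha> X by blast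
next
  fix \<alpha> assume "\<alpha> \<in> ?R"
  then obtain X where \<alpha>: "\<alpha> \<noteq> 0" and X: "X \<in> V" "X \<noteq> 0\<^sub>m (2 * n) (2 * n)"
    and e: "\<And>p q. p < 2 * n \<Longrightarrow> q < 2 * n \<Longrightarrow> X $$ (p, q) \<noteq> 0 \<Longrightarrow> \<alpha> = \<eta> n p - \<eta> n q"
    by blast
  have c: "X \<in> carrier_mat (2 * n) (2 * n)" using X assms by blast
  have "\<exists>p<2 * n. \<exists>q<2 * n. X $$ (p, q) \<noteq> 0"
  proof (rule ccontr)
    assume "\<not> ?thesis"
    then have "X = 0\<^sub>m (2 * n) (2 * n)"
      by (intro eq_matI) (use c in auto)
    then show False using X by blast
  qed
  then have "\<alpha> \<in> weight_space n" using e eta_weight_space by blast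
  moreover have "super_bracket n (torus n a) X = weight_at n \<alpha> (torus n a) \<cdot>\<^sub>m X" for a
    unfolding super_bracket_torus[OF c] by (rule eq_matI) (use c e in fastforce)+
  ultimately show "\<alpha> \<in> roots_of n V"
    unfolding roots_of_def cartan_eq using \<alpha> X by blast
qed

lemma nonzero_entry:
  assumes "X \<noteq> 0\<^sub>m m k" "X \<in> carrier_mat m k"
  obtains p q where "p < m" "q < k" "X $$ (p, q) \<noteq> 0"
proof -
  have "\<exists>p<m. \<exists>q<k. X $$ (p, q) \<noteq> 0"
  proof (rule ccontr)
    assume "\<not> ?thesis"
    then have "X = 0\<^sub>m m k" by (intro eq_matI) (use assms(2) in auto)
    then show False using assms(1) by blast
  qed
  then show ?thesis using that by blast
qed

lemma periplectic_m1_carrier: "periplectic_m1 n \<subseteq> carrier_mat (2 * n) (2 * n)"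
  and periplectic_0_carrier: "periplectic_0 n \<subseteq> carrier_mat (2 * n) (2 * n)"
  and periplectic_1_carrier: "periplectic_1 n \<subseteq> carrier_mat (2 * n) (2 * n)"
  unfolding periplectic_m1_def periplectic_0_def periplectic_1_def
  by (auto intro!: carrier_matI)

lemma eps_ne: "\<epsilon> i + \<epsilon> j \<noteq> 0" "i \<noteq> j \<Longrightarrow> \<epsilon> i \<noteq> \<epsilon> j"
proof -
  have "coord (\<epsilon> i + \<epsilon> j) i \<noteq> 0" by simp
  then show "\<epsilon> i + \<epsilon> j \<noteq> 0" by (metis coord_simps(1))
  assume "i \<noteq> j"
  then have "coord (\<epsilon> i) i \<noteq> coord (\<epsilon> j) i" by simp
  then show "\<epsilon> i \<noteq> \<epsilon> j" by metis
qed

lemma skew_entry: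
  fixes C :: "complex mat"
  assumes "C \<in> carrier_mat n n" "C\<^sup>T = - C" "p < n" "q < n"
  shows "C $$ (q, p) = - C $$ (p, q)"
proof -
  have "C\<^sup>T $$ (p, q) = (- C) $$ (p, q)" by (simp add: assms(2))
  then show ?thesis using assms(1,3,4) by simp
qed

lemma pos_odd_roots_eq:
  "pos_odd_roots n = {- (\<epsilon> i + \<epsilon> j) | i j. 1 \<le> i \<and> i < j \<and> j \<le> n}" (is "_ = ?R")
proof (intro equalityI subsetI)
  fix \<alpha> assume "\<alpha> \<in> pos_odd_roots n"
  then obtain X where X: "X \<in> periplectic_m1 n" and "\<alpha> \<noteq> 0" and nz': "X \<noteq> 0\<^sub>m (2 * n) (2 * n)"
    and e0: "\<And>p q. p < 2 * n \<Longrightarrow> q < 2 * n \<Longrightarrow> X $$ (p, q) \<noteq> 0 \<Longrightarrow> \<alpha> = \<eta> n p - \<eta> n q"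
    unfolding pos_odd_roots_def roots_of_eq[OF periplectic_m1_carrier] by blast
  from X obtain C where C: "C \<in> carrier_mat n n" "C\<^sup>T = - C"
    and XX: "X = four_block_mat (0\<^sub>m n n) (0\<^sub>m n n) C (0\<^sub>m n n)"
    unfolding periplectic_m1_def by blast
  note nz = nz'[unfolded XX] and e = e0[unfolded XX]
  have e': "\<alpha> = - (\<epsilon> (Suc q) + \<epsilon> (Suc p))" if "p < n" "q < n" "C $$ (p, q) \<noteq> 0" for p q
    using e[of "n + p" q] that C by (simp add: \<eta>_def)
  have "C \<noteq> 0\<^sub>m n n"
  proof
    assume "C = 0\<^sub>m n n"
    then have "four_block_mat (0\<^sub>m n n) (0\<^sub>m n n) C (0\<^sub>m n n) = 0\<^sub>m (2 * n) (2 * n)"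
      by (intro eq_matI) auto
    then show False using nz by blast
  qed
  then obtain p q where pq: "p < n" "q < n" "C $$ (p, q) \<noteq> 0"
    using C nonzero_entry by metis
  have "p \<noteq> q"
    using skew_entry[OF C pq(1,2)] pq(3) by auto
  then have lt: "Suc (min p q) < Suc (max p q)" by auto
  have "\<alpha> = - (\<epsilon> (Suc (min p q)) + \<epsilon> (Suc (max p q)))"
    using e'[OF pq] by (cases "p \<le> q") (simp_all add: add.commute)
  moreover have "1 \<le> Suc (min p q)" "Suc (max p q) \<le> n"
    using pq by auto
  ultimately show "\<alpha> \<in> ?R" using lt by blast
next
  fix \<alpha> assume "\<alpha> \<in> ?R"
  then obtain i j where ij: "\<alpha> = - (\<epsilon> i + \<epsilon> j)" "1 \<le> i" "i < j" "j \<le> n" by blast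
  obtain a b where ab: "i = Suc a" "j = Suc b"
    using ij by (metis Suc_le_D One_nat_def less_or_eq_imp_le order_trans)
  have lt: "a < b" "b < n" using ij ab by auto
  let ?C = "mat n n (\<lambda>(p, q). if p = a \<and> q = b then 1
    else if p = b \<and> q = a then - 1 else 0) :: complex mat"
  let ?X = "four_block_mat (0\<^sub>m n n) (0\<^sub>m n n) ?C (0\<^sub>m n n)"
  have "?C\<^sup>T = - ?C" by (rule eq_matI) (use lt in auto)
  moreover have "?C \<in> carrier_mat n n" by simp
  ultimately have "?X \<in> periplectic_m1 n" unfolding periplectic_m1_def by blast
  moreover have "?X \<noteq> 0\<^sub>m (2 * n) (2 * n)"
  proof
    assume "?X = 0\<^sub>m (2 * n) (2 * n)"
    then have "?X $$ (n + (a), b) = 0\<^sub>m (2 * n) (2 * n) $$ (n + (a), b)" by metis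
    then show False using lt by simp
  qed
  moreover have "\<forall>p<2 * n. \<forall>q<2 * n. ?X $$ (p, q) \<noteq> 0 \<longrightarrow> \<alpha> = \<eta> n p - \<eta> n q"
    using ij(1) ab lt by (auto simp: \<eta>_def split: if_splits)
  moreover have "\<alpha> \<noteq> 0" using eps_ne(1) unfolding ij(1) neg_equal_0_iff_equal .
  ultimately show "\<alpha> \<in> pos_odd_roots n"
    unfolding pos_odd_roots_def roots_of_eq[OF periplectic_m1_carrier] by blast
qed

lemma roots_of_periplectic_1:
  "roots_of n (periplectic_1 n) = {\<epsilon> i + \<epsilon> j | i j. 1 \<le> i \<and> i \<le> j \<and> j \<le> n}" (is "_ = ?R")
proof (intro equalityI subsetI)
  fix \<alpha> assume "\<alpha> \<in> roots_of n (periplectic_1 n)"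
  then obtain X where X: "X \<in> periplectic_1 n" and "\<alpha> \<noteq> 0" and nz': "X \<noteq> 0\<^sub>m (2 * n) (2 * n)"
    and e0: "\<And>p q. p < 2 * n \<Longrightarrow> q < 2 * n \<Longrightarrow> X $$ (p, q) \<noteq> 0 \<Longrightarrow> \<alpha> = \<eta> n p - \<eta> n q"
    unfolding roots_of_eq[OF periplectic_1_carrier] by blast
  from X obtain B where B: "B \<in> carrier_mat n n"
    and XX: "X = four_block_mat (0\<^sub>m n n) B (0\<^sub>m n n) (0\<^sub>m n n)"
    unfolding periplectic_1_def by blast
  note nz = nz'[unfolded XX] and e = e0[unfolded XX]
  have e': "\<alpha> = \<epsilon> (Suc p) + \<epsilon> (Suc q)" if "p < n" "q < n" "B $$ (p, q) \<noteq> 0" for p q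
    using e[of p "n + q"] that B by (simp add: \<eta>_def)
  have "B \<noteq> 0\<^sub>m n n"
  proof
    assume "B = 0\<^sub>m n n"
    then have "four_block_mat (0\<^sub>m n n) B (0\<^sub>m n n) (0\<^sub>m n n) = 0\<^sub>m (2 * n) (2 * n)"
      by (intro eq_matI) auto
    then show False using nz by blast
  qed
  then obtain p q where pq: "p < n" "q < n" "B $$ (p, q) \<noteq> 0"
    using B nonzero_entry by metis
  have "\<alpha> = \<epsilon> (Suc (min p q)) + \<epsilon> (Suc (max p q))"
    using e'[OF pq] by (cases "p \<le> q") (simp_all add: add.commute)
  moreover have "1 \<le> Suc (min p q)" "Suc (min p q) \<le> Suc (max p q)" "Suc (max p q) \<le> n"
    using pq by auto
  ultimately show "\<alpha> \<in> ?R" by blast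
next
  fix \<alpha> assume "\<alpha> \<in> ?R"
  then obtain i j where ij: "\<alpha> = \<epsilon> i + \<epsilon> j" "1 \<le> i" "i \<le> j" "j \<le> n" by blast
  obtain a b where ab: "i = Suc a" "j = Suc b"
    using ij by (metis Suc_le_D One_nat_def order_trans)
  have lt: "a < n" "b < n" using ij ab by auto
  let ?B = "mat n n (\<lambda>(p, q). if p = a \<and> q = b \<or> p = b \<and> q = a then 1 else 0)
    :: complex mat"
  let ?X = "four_block_mat (0\<^sub>m n n) ?B (0\<^sub>m n n) (0\<^sub>m n n)"
  have "?B\<^sup>T = ?B" by (rule eq_matI) auto
  moreover have "?B \<in> carrier_mat n n" by simp
  ultimately have "?X \<in> periplectic_1 n" unfolding periplectic_1_def by blast
  moreover have "?X \<noteq> 0\<^sub>m (2 * n) (2 * n)"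
  proof
    assume "?X = 0\<^sub>m (2 * n) (2 * n)"
    then have "?X $$ (a, n + (b)) = 0\<^sub>m (2 * n) (2 * n) $$ (a, n + (b))" by metis
    then show False using lt by simp
  qed
  moreover have "\<forall>p<2 * n. \<forall>q<2 * n. ?X $$ (p, q) \<noteq> 0 \<longrightarrow> \<alpha> = \<eta> n p - \<eta> n q"
    using ij(1) ab lt by (auto simp: \<eta>_def add.commute split: if_splits)
  moreover have "\<alpha> \<noteq> 0" using eps_ne(1) unfolding ij(1) .
  ultimately show "\<alpha> \<in> roots_of n (periplectic_1 n)"
    unfolding roots_of_eq[OF periplectic_1_carrier] by blast
qed

lemma roots_of_periplectic_0:
  "roots_of n (periplectic_0 n) = {\<epsilon> i - \<epsilon> j | i j. i \<in> {1..n} \<and> j \<in> {1..n} \<and> i \<noteq> j}"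
  (is "_ = ?R")
proof (intro equalityI subsetI)
  fix \<alpha> assume "\<alpha> \<in> roots_of n (periplectic_0 n)"
  then obtain X where X: "X \<in> periplectic_0 n" and "\<alpha> \<noteq> 0" and nz': "X \<noteq> 0\<^sub>m (2 * n) (2 * n)"
    and e0: "\<And>p q. p < 2 * n \<Longrightarrow> q < 2 * n \<Longrightarrow> X $$ (p, q) \<noteq> 0 \<Longrightarrow> \<alpha> = \<eta> n p - \<eta> n q"
    unfolding roots_of_eq[OF periplectic_0_carrier] by blast
  from X obtain A where A: "A \<in> carrier_mat n n"
    and XX: "X = four_block_mat A (0\<^sub>m n n) (0\<^sub>m n n) (- A\<^sup>T)"
    unfolding periplectic_0_def by blast
  note nz = nz'[unfolded XX] and e = e0[unfolded XX]
  have e': "\<alpha> = \<epsilon> (Suc p) - \<epsilon> (Suc q)" if "p < n" "q < n" "A $$ (p, q) \<noteq> 0" for p q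
    using e[of p q] that A by (simp add: \<eta>_def)
  have "A \<noteq> 0\<^sub>m n n"
  proof
    assume "A = 0\<^sub>m n n"
    then have "four_block_mat A (0\<^sub>m n n) (0\<^sub>m n n) (- A\<^sup>T) = 0\<^sub>m (2 * n) (2 * n)"
      by (intro eq_matI) auto
    then show False using nz by blast
  qed
  then obtain p q where pq: "p < n" "q < n" "A $$ (p, q) \<noteq> 0"
    using A nonzero_entry by metis
  moreover have "p \<noteq> q" using e'[OF pq] \<open>\<alpha> \<noteq> 0\<close> by auto
  moreover have "Suc p \<in> {1..n}" "Suc q \<in> {1..n}" using pq by auto
  ultimately show "\<alpha> \<in> ?R"
    using e'[OF pq] by blast
next
  fix \<alpha> assume "\<alpha> \<in> ?R"
  then obtain i j where ij: "\<alpha> = \<epsilon> i - \<epsilon> j" "1 \<le> i" "i \<le> n" "1 \<le> j" "j \<le> n" "i \<noteq> j" by auto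
  obtain a b where ab: "i = Suc a" "j = Suc b"
    using ij by (metis Suc_le_D One_nat_def order_trans)
  have lt: "a < n" "b < n" using ij ab by auto
  let ?A = "mat n n (\<lambda>(p, q). if p = a \<and> q = b then 1 else 0) :: complex mat"
  let ?X = "four_block_mat ?A (0\<^sub>m n n) (0\<^sub>m n n) (- ?A\<^sup>T)"
  have "?A \<in> carrier_mat n n" by simp
  then have "?X \<in> periplectic_0 n" unfolding periplectic_0_def by blast
  moreover have "?X \<noteq> 0\<^sub>m (2 * n) (2 * n)"
  proof
    assume "?X = 0\<^sub>m (2 * n) (2 * n)"
    then have "?X $$ (a, b) = 0\<^sub>m (2 * n) (2 * n) $$ (a, b)" by metis
    then show False using lt by simp
  qed
  moreover have "\<forall>p<2 * n. \<forall>q<2 * n. ?X $$ (p, q) \<noteq> 0 \<longrightarrow> \<alpha> = \<eta> n p - \<eta> n q"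
    using ij(1) ab lt by (auto simp: \<eta>_def split: if_splits)
  moreover have "\<alpha> \<noteq> 0" using eps_ne(2)[OF ij(6)] ij(1) by simp
  ultimately show "\<alpha> \<in> roots_of n (periplectic_0 n)"
    unfolding roots_of_eq[OF periplectic_0_carrier] by blast
qed

lemma pair_eq_of_eps_sum:
  assumes "\<epsilon> i + \<epsilon> j = \<epsilon> k + \<epsilon> l" "i < j" "k < l"
  shows "i = k \<and> j = l"
proof -
  have "coord (\<epsilon> i + \<epsilon> j) m = coord (\<epsilon> k + \<epsilon> l) m" for m by (simp add: assms(1))
  from this[of i] this[of j] this[of k] this[of l] show ?thesis
    using assms(2,3) by (auto split: if_splits)
qed

lemma pair_eq_of_eps_diff:
  assumes "\<epsilon> i - \<epsilon> j = \<epsilon> k - \<epsilon> l" "i < j" "k < l"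
  shows "i = k \<and> j = l"
proof -
  have "coord (\<epsilon> i - \<epsilon> j) m = coord (\<epsilon> k - \<epsilon> l) m" for m by (simp add: assms(1))
  from this[of i] this[of j] have "(1 :: complex) = (if i = k then 1 else 0) - (if i = l then 1 else 0)"
    "(- 1 :: complex) = (if j = k then 1 else 0) - (if j = l then 1 else 0)"
    using assms(2) by simp_all
  then show ?thesis by (simp split: if_splits)
qed

lemma denominator_eq:
  "denominator n =
    (\<Prod>(i, j) | 1 \<le> i \<and> i < j \<and> j \<le> n. 1 - fexp (- (\<epsilon> i - \<epsilon> j))) /
    (\<Prod>(i, j) | 1 \<le> i \<and> i < j \<and> j \<le> n. 1 - fexp (\<epsilon> i + \<epsilon> j))"
proof -
  let ?P = "{(i, j). 1 \<le> i \<and> i < j \<and> j \<le> n}"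
  have e: "pos_even_roots n = (\<lambda>(i, j). \<epsilon> i - \<epsilon> j) ` ?P"
    unfolding pos_even_roots_def by fast
  have o: "pos_odd_roots n = (\<lambda>(i, j). - (\<epsilon> i + \<epsilon> j)) ` ?P"
    unfolding pos_odd_roots_eq by fast
  have ie: "inj_on (\<lambda>(i, j). \<epsilon> i - \<epsilon> j) ?P"
  proof (rule inj_onI)
    fix x y
    assume x: "x \<in> ?P" and y: "y \<in> ?P"
      and eq: "(\<lambda>(i, j). \<epsilon> i - \<epsilon> j) x = (\<lambda>(i, j). \<epsilon> i - \<epsilon> j) y"
    obtain i j k l where xy: "x = (i, j)" "y = (k, l)" by fastforce
    have "\<epsilon> i - \<epsilon> j = \<epsilon> k - \<epsilon> l" using eq unfolding xy prod.case .
    then show "x = y" using pair_eq_of_eps_diff[of i j k l] x y xy by simp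
  qed
  have io: "inj_on (\<lambda>(i, j). - (\<epsilon> i + \<epsilon> j)) ?P"
  proof (rule inj_onI)
    fix x y
    assume x: "x \<in> ?P" and y: "y \<in> ?P"
      and eq: "(\<lambda>(i, j). - (\<epsilon> i + \<epsilon> j)) x = (\<lambda>(i, j). - (\<epsilon> i + \<epsilon> j)) y"
    obtain i j k l where xy: "x = (i, j)" "y = (k, l)" by fastforce
    have "\<epsilon> i + \<epsilon> j = \<epsilon> k + \<epsilon> l" using eq unfolding xy prod.case neg_equal_iff_equal .
    then show "x = y" using pair_eq_of_eps_sum[of i j k l] x y xy by simp
  qed
  show ?thesis
    unfolding denominator_def e o prod.reindex[OF ie] prod.reindex[OF io]
    by (intro arg_cong2[of _ _ _ _ "(/)"] prod.cong) (auto simp: add.commute)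
qed

end

theory Submission
  imports Defs "HOL-Computational_Algebra.Polynomial"
begin

text \<open>
  With \<open>x i = fexp (\<epsilon> i)\<close> the left-hand side is the product of \<open>(x i - x j) / (1 - x i * x j)\<close> over
  \<open>1 \<le> i < j \<le> n\<close>, so the theorem is Schur's Pfaffian identity written as an alternating sum over
  \<open>S\<^sub>n\<close>. Lagrange interpolation in the variable \<open>x m\<close> expands this product along the index \<open>m\<close>; every
  term of the expansion is a signed transposition applied to the term that pairs the two smallest
  indices. All terms therefore contribute equally to the alternating sum, and splitting off one
  pair from \<open>2 * i\<close> indices costs the factor \<open>2 * (2 * i - 1)\<close>: a choice of partner, and the two
  halves of \<open>(a - b) / (1 - a * b) = a / (1 - a * b) - b / (1 - b * a)\<close>. The product of these
  factors is \<open>(2 * r)! / r!\<close>. For odd \<open>n\<close> one first splits off an unpaired index, which is the same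
  interpolation at the point 1.
\<close>

section \<open>Lagrange interpolation\<close>

text \<open>Divided by the product of the \<open>1 - x i * t\<close>, this expands the product of
  the Moebius factors \<open>(x i - t) / (1 - x i * t)\<close> in its simple poles
  \<open>1 / x j\<close>. Each factor is 1 at \<open>t = - 1\<close> and \<open>- 1\<close> at
  \<open>t = 1\<close>; for odd \<open>card I\<close> the whole product has the same two values, and
  this excludes an additive constant.\<close>

lemma interpolation_identity:
  fixes x :: "'b \<Rightarrow> 'a :: field_char_0"
  assumes fin: "finite I" and odd: "odd (card I)" and inj: "inj_on x I"
    and nz: "\<And>i. i \<in> I \<Longrightarrow> x i \<noteq> 0 \<and> x i \<noteq> 1 \<and> x i \<noteq> - 1"
  shows "(\<Prod>i\<in>I. x i - t) =
    (\<Sum>j\<in>I. (\<Prod>i\<in>I-{j}. (1 - x i * x j) / (x i - x j)) * ((x j - t) * (\<Prod>i\<in>I-{j}. 1 - x i * t)))"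
proof -
  \<comment> \<open>The value at \<open>1 / x j\<close> of the product of the other factors
    \<open>(x i - t) / (1 - x i * t)\<close>.\<close>
  define B where "B j = (\<Prod>i\<in>I-{j}. (1 - x i * x j) / (x i - x j))" for j
  define P where "P = (\<Prod>i\<in>I. [:x i, - 1:])"
  define Q where "Q = (\<Prod>i\<in>I. [:1, - x i:])"
  define S where "S = (\<Sum>j\<in>I. smult (B j) ([:x j, - 1:] * (\<Prod>i\<in>I-{j}. [:1, - x i:])))"
  define s where "s = sum B I - 1"
  \<comment> \<open>\<open>P\<close> and \<open>S\<close> agree at the roots \<open>1 / x i\<close> of \<open>Q\<close>. Adding \<open>s\<close> times \<open>Q\<close> makes them agree at 1 too,
    more points than the degree \<open>card I\<close>; the value at \<open>- 1\<close> then forces \<open>s = 0\<close>.\<close>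
  define A where "A = insert 1 ((\<lambda>i. 1 / x i) ` I)"
  have card_pos: "card I \<ge> 1"
    using odd by (cases "card I") auto
  have polyP: "poly P u = (\<Prod>i\<in>I. x i - u)" for u
    by (simp add: P_def poly_prod)
  have polyQ: "poly Q u = (\<Prod>i\<in>I. 1 - x i * u)" for u
    by (simp add: Q_def poly_prod algebra_simps)
  have polyS: "poly S u = (\<Sum>j\<in>I. B j * ((x j - u) * (\<Prod>i\<in>I-{j}. 1 - x i * u)))" for u
    by (simp add: S_def poly_sum poly_prod algebra_simps)
  have degP: "degree P \<le> card I"
    unfolding P_def by (rule order.trans[OF degree_prod_sum_le[OF fin]]) (simp add: o_def)
  have degQ: "degree (\<Prod>i\<in>J. [:1, - x i:]) \<le> card J" if "J \<subseteq> I" for J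
  proof -
    have fJ: "finite J" using that fin finite_subset by blast
    have "sum (degree \<circ> (\<lambda>i. [:1, - x i:])) J \<le> (\<Sum>i\<in>J. 1)"
      by (rule sum_mono) simp
    then show ?thesis
      using degree_prod_sum_le[OF fJ, of "\<lambda>i. [:1, - x i:]"] by simp
  qed
  have degS: "degree S \<le> card I"
    unfolding S_def
  proof (rule degree_sum_le[OF fin])
    fix j assume j: "j \<in> I"
    have "degree ([:x j, - 1:] * (\<Prod>i\<in>I-{j}. [:1, - x i:])) \<le> 1 + card (I - {j})"
      using degree_mult_le[of "[:x j, - 1:]" "\<Prod>i\<in>I-{j}. [:1, - x i:]"] degQ[of "I - {j}"] by simp
    also have "\<dots> = card I"
      using j fin card_pos by simp
    finally show "degree (smult (B j) ([:x j, - 1:] * (\<Prod>i\<in>I-{j}. [:1, - x i:]))) \<le> card I"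
      using degree_smult_le order.trans by blast
  qed
  have cardA: "card A = Suc (card I)"
  proof -
    have "inj_on (\<lambda>i. 1 / x i) I"
      using inj nz by (auto simp: inj_on_def field_simps)
    moreover have "1 \<notin> (\<lambda>i. 1 / x i) ` I"
      using nz by auto
    ultimately show ?thesis
      unfolding A_def using fin by (simp add: card_image)
  qed
  have fac: "(\<Prod>i\<in>I. f i) = f j * (\<Prod>i\<in>I-{j}. f i)" if "j \<in> I" for j and f :: "'b \<Rightarrow> 'a"
    using that fin by (simp add: prod.remove)
  have PS: "P = S + smult s Q"
  proof (rule poly_eqI_degree)
    fix u assume "u \<in> A"
    then consider "u = 1" | k where "k \<in> I" "u = 1 / x k" by (auto simp: A_def)
    then show "poly P u = poly (S + smult s Q) u"
    proof cases
      case 1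
      have "(x j - 1) * (\<Prod>i\<in>I-{j}. 1 - x i) = - (\<Prod>i\<in>I. 1 - x i)" if "j \<in> I" for j
        using fac[OF that, of "\<lambda>i. 1 - x i"] by (simp add: algebra_simps)
      then have "poly S 1 = (\<Sum>j\<in>I. B j * - (\<Prod>i\<in>I. 1 - x i))"
        by (simp add: polyS)
      also have "\<dots> = - (sum B I * (\<Prod>i\<in>I. 1 - x i))"
        by (simp add: sum_distrib_right sum_negf)
      finally have "poly S 1 = - (sum B I * (\<Prod>i\<in>I. 1 - x i))" .
      moreover have "poly P 1 = - (\<Prod>i\<in>I. 1 - x i)"
      proof -
        have "poly P 1 = (\<Prod>i\<in>I. (- 1) * (1 - x i))" by (simp add: polyP)
        also have "\<dots> = (- 1) ^ card I * (\<Prod>i\<in>I. 1 - x i)"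
          unfolding prod.distrib by simp
        finally show ?thesis using odd by simp
      qed
      ultimately show ?thesis
        by (simp add: 1 polyQ s_def algebra_simps)
    next
      case 2
      have xk: "x k \<noteq> 0" using nz 2 by blast
      have "poly S u = (\<Sum>j\<in>I. if j = k then B k * ((x k - u) * (\<Prod>i\<in>I-{k}. 1 - x i * u)) else 0)"
        unfolding polyS
      proof (rule sum.cong[OF refl])
        fix j assume j: "j \<in> I"
        show "B j * ((x j - u) * (\<Prod>i\<in>I-{j}. 1 - x i * u)) =
          (if j = k then B k * ((x k - u) * (\<Prod>i\<in>I-{k}. 1 - x i * u)) else 0)"
        proof (cases "j = k")
          case False
          then have "(\<Prod>i\<in>I-{j}. 1 - x i * u) = 0"
            using fin 2 xk by (intro prod_zero) auto
          then show ?thesis using False by simp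
        qed simp
      qed
      also have "\<dots> = B k * ((x k - u) * (\<Prod>i\<in>I-{k}. 1 - x i * u))"
        using fin 2 by simp
      also have "\<dots> = (x k - u) * (\<Prod>i\<in>I-{k}. (1 - x i * x k) / (x i - x k) * (1 - x i * u))"
        unfolding B_def prod.distrib by (simp only: ac_simps)
      also have "(\<Prod>i\<in>I-{k}. (1 - x i * x k) / (x i - x k) * (1 - x i * u)) = (\<Prod>i\<in>I-{k}. x i - u)"
      proof (rule prod.cong[OF refl])
        fix i assume i: "i \<in> I - {k}"
        then have "x i - x k \<noteq> 0" using inj 2 by (auto simp: inj_on_def)
        then show "(1 - x i * x k) / (x i - x k) * (1 - x i * u) = x i - u"
          using xk by (simp add: 2 divide_simps) (simp add: algebra_simps)
      qed
      also have "(x k - u) * (\<Prod>i\<in>I-{k}. x i - u) = poly P u"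
        unfolding polyP using fac 2 by metis
      finally have "poly S u = poly P u" .
      moreover have "poly Q u = 0"
        unfolding polyQ using fin 2 xk by (intro prod_zero) auto
      ultimately show ?thesis by simp
    qed
  next
    show "degree P < card A" using degP cardA by simp
    have "degree (S + smult s Q) \<le> card I"
      using degS degQ[of I] by (intro degree_add_le order.trans[OF degree_smult_le]) (auto simp: Q_def)
    then show "degree (S + smult s Q) < card A" using cardA by simp
  qed
  have "poly P (- 1) = (\<Prod>i\<in>I. 1 + x i)" "poly Q (- 1) = (\<Prod>i\<in>I. 1 + x i)"
    by (simp_all add: polyP polyQ add.commute)
  moreover have "poly S (- 1) = sum B I * (\<Prod>i\<in>I. 1 + x i)"
  proof -
    have "(x j - (- 1)) * (\<Prod>i\<in>I-{j}. 1 - x i * (- 1)) = (\<Prod>i\<in>I. 1 + x i)" if "j \<in> I" for j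
      using fac[OF that, of "\<lambda>i. 1 + x i"] by (simp add: algebra_simps)
    then show ?thesis unfolding polyS by (simp add: sum_distrib_right)
  qed
  moreover have "(\<Prod>i\<in>I. 1 + x i) \<noteq> 0"
    using fin nz by (auto simp: add_eq_0_iff)
  moreover have "poly P (- 1) = poly S (- 1) + s * poly Q (- 1)"
    using PS by (metis poly_add poly_smult)
  \<comment> \<open>The values at \<open>- 1\<close> give
    \<open>1 = sum B I + s = 1 + 2 * s\<close>, and the characteristic is 0.\<close>
  ultimately have "s = 0"
    by (simp add: s_def algebra_simps)
  then have "poly P t = poly S t" using PS by simp
  then show ?thesis unfolding polyP polyS B_def .
qed

section \<open>The product of the factors of Schur\<close>

definition ordered_pairs :: "nat set \<Rightarrow> (nat \<times> nat) set" where
  "ordered_pairs S = {(i, j). i \<in> S \<and> j \<in> S \<and> i < j}"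

definition schur_factor :: "(nat \<Rightarrow> 'a) \<Rightarrow> nat \<Rightarrow> nat \<Rightarrow> 'a :: field" where
  "schur_factor x i j = (x i - x j) / (1 - x i * x j)"

definition schur_prod :: "(nat \<Rightarrow> 'a) \<Rightarrow> nat set \<Rightarrow> 'a :: field" where
  "schur_prod x S = (\<Prod>(i, j)\<in>ordered_pairs S. schur_factor x i j)"

lemma finite_ordered_pairs [simp]: "finite S \<Longrightarrow> finite (ordered_pairs S)"
  by (rule finite_subset[of _ "S \<times> S"]) (auto simp: ordered_pairs_def)

lemma schur_factor_swap: "schur_factor x j i = - schur_factor x i j"
  by (simp add: schur_factor_def minus_divide_left mult.commute)

lemma schur_prod_insert_less:
  assumes "finite S" "\<And>i. i \<in> S \<Longrightarrow> m < i"
  shows "schur_prod x (insert m S) = (\<Prod>i\<in>S. schur_factor x m i) * schur_prod x S"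
proof -
  have "ordered_pairs (insert m S) = Pair m ` S \<union> ordered_pairs S"
    using assms(2) by (fastforce simp: ordered_pairs_def)
  moreover have "Pair m ` S \<inter> ordered_pairs S = {}"
    using assms(2) by (fastforce simp: ordered_pairs_def)
  ultimately show ?thesis
    using assms(1) by (simp add: schur_prod_def prod.union_disjoint prod.reindex inj_on_def)
qed

lemma schur_prod_insert_greater:
  assumes "finite S" "\<And>i. i \<in> S \<Longrightarrow> i < m"
  shows "schur_prod x (insert m S) = (\<Prod>i\<in>S. schur_factor x i m) * schur_prod x S"
proof -
  have "ordered_pairs (insert m S) = (\<lambda>i. (i, m)) ` S \<union> ordered_pairs S"
    using assms(2) by (fastforce simp: ordered_pairs_def)
  moreover have "(\<lambda>i. (i, m)) ` S \<inter> ordered_pairs S = {}"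
    using assms(2) by (fastforce simp: ordered_pairs_def)
  ultimately show ?thesis
    using assms(1) by (simp add: schur_prod_def prod.union_disjoint prod.reindex inj_on_def)
qed

section \<open>Antisymmetry of the product under permutations\<close>

text \<open>Determines the inversions of a transposition, whose number decides the sign in
  \<open>schur_prod_transpose\<close>.\<close>

lemma transpose_inversion_iff:
  assumes "(a :: nat) < b" "i < j"
  shows "Transposition.transpose a b j < Transposition.transpose a b i \<longleftrightarrow>
    i = a \<and> j \<le> b \<or> j = b \<and> a \<le> i"
proof -
  consider "i = a" "j = b" | "i = a" "j \<noteq> b" | "i = b" | "j = a" | "i \<noteq> a" "j = b" | "i \<notin> {a, b}" "j \<notin> {a, b}"
    by blast
  then show ?thesis
    using assms by cases auto
qed

text \<open>A transposition permutes the unordered pairs of \<open>S\<close>; by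
  \<open>schur_factor_swap\<close> each pair whose order it reverses contributes a factor
  \<open>- 1\<close>, and the number of these pairs is odd.\<close>

lemma schur_prod_transpose:
  assumes fin: "finite S" and "a \<in> S" "b \<in> S" "a < b"
  shows "schur_prod (x \<circ> Transposition.transpose a b) S = - schur_prod x S"
proof -
  define \<tau> where "\<tau> = Transposition.transpose a b"
  \<comment> \<open>\<open>\<phi>\<close> puts the image of a pair back into increasing order, and
    \<open>e\<close> is the sign that this costs.\<close>
  define e where "e = (\<lambda>(i, j). if \<tau> i < \<tau> j then 1 else - 1 :: 'a)"
  define \<phi> where "\<phi> = (\<lambda>(i, j). (min (\<tau> i) (\<tau> j), max (\<tau> i) (\<tau> j)))"
  have \<tau>S: "\<tau> i \<in> S \<longleftrightarrow> i \<in> S" for i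
    using assms(2,3) by (auto simp: \<tau>_def Transposition.transpose_def)
  have \<tau>\<tau> [simp]: "\<tau> (\<tau> i) = i" for i by (simp add: \<tau>_def)
  have \<tau>inj: "\<tau> i = \<tau> j \<longleftrightarrow> i = j" for i j by (metis \<tau>\<tau>)
  have \<phi>: "\<phi> p \<in> ordered_pairs S" "\<phi> (\<phi> p) = p" if pS: "p \<in> ordered_pairs S" for p
  proof -
    obtain i j where p: "p = (i, j)" "i \<in> S" "j \<in> S" "i < j"
      using pS by (auto simp: ordered_pairs_def)
    have "\<tau> i \<noteq> \<tau> j" using p \<tau>inj by simp
    then show "\<phi> p \<in> ordered_pairs S" "\<phi> (\<phi> p) = p"
      using p by (auto simp: \<phi>_def ordered_pairs_def \<tau>S min_def max_def)
  qed
  have "schur_prod (x \<circ> \<tau>) S = (\<Prod>p\<in>ordered_pairs S. e p * (case \<phi> p of (i, j) \<Rightarrow> schur_factor x i j))"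
    unfolding schur_prod_def
  proof (rule prod.cong[OF refl])
    fix p assume "p \<in> ordered_pairs S"
    then obtain i j where p: "p = (i, j)" "i < j" by (auto simp: ordered_pairs_def)
    show "(case p of (i, j) \<Rightarrow> schur_factor (x \<circ> \<tau>) i j) = e p * (case \<phi> p of (i, j) \<Rightarrow> schur_factor x i j)"
      using schur_factor_swap[of x "\<tau> j" "\<tau> i"]
      by (auto simp: p e_def \<phi>_def min_def max_def schur_factor_def)
  qed
  also have "\<dots> = prod e (ordered_pairs S) * (\<Prod>p\<in>ordered_pairs S. case \<phi> p of (i, j) \<Rightarrow> schur_factor x i j)"
    by (rule prod.distrib)
  also have "(\<Prod>p\<in>ordered_pairs S. case \<phi> p of (i, j) \<Rightarrow> schur_factor x i j) = schur_prod x S"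
    unfolding schur_prod_def
    by (rule prod.reindex_bij_witness[of _ \<phi> \<phi>]) (auto simp: \<phi>)
  also have "prod e (ordered_pairs S) = - 1"
  proof -
    \<comment> \<open>Every \<open>c\<close> in \<open>M\<close> yields the two inverted pairs
      \<open>(a, c)\<close> and \<open>(c, b)\<close>. Together with \<open>(a, b)\<close> the count
      is odd.\<close>
    define M where "M = {c \<in> S. a < c \<and> c < b}"
    define N where "N = {p \<in> ordered_pairs S. \<not> \<tau> (fst p) < \<tau> (snd p)}"
    have "\<not> \<tau> i < \<tau> j \<longleftrightarrow> i = a \<and> j \<le> b \<or> j = b \<and> a \<le> i" if "i < j" for i j
      using transpose_inversion_iff[OF \<open>a < b\<close> that] \<tau>inj[of i j] that
      by (simp add: \<tau>_def not_less le_less)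
    then have "N = {(i, j) \<in> ordered_pairs S. i = a \<and> j \<le> b \<or> j = b \<and> a \<le> i}"
      by (simp add: set_eq_iff N_def ordered_pairs_def cong: conj_cong)
    also have "\<dots> = insert (a, b) (Pair a ` M \<union> (\<lambda>c. (c, b)) ` M)"
      using assms(2-4) by (auto simp: ordered_pairs_def M_def)
    finally have N: "N = insert (a, b) (Pair a ` M \<union> (\<lambda>c. (c, b)) ` M)" .
    have finM: "finite M" using fin by (simp add: M_def)
    have "card (Pair a ` M \<union> (\<lambda>c. (c, b)) ` M) = card M + card M"
      using finM by (subst card_Un_disjoint) (auto simp: card_image inj_on_def M_def)
    moreover have "(a, b) \<notin> Pair a ` M \<union> (\<lambda>c. (c, b)) ` M"
      by (auto simp: M_def)
    ultimately have "odd (card N)"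
      using finM by (simp add: N)
    moreover have "prod e (ordered_pairs S) = (\<Prod>p\<in>ordered_pairs S. if p \<in> N then - 1 else 1)"
      by (rule prod.cong) (auto simp: e_def N_def)
    moreover have "\<dots> = (- 1) ^ card N"
      using fin by (simp add: prod.If_cases N_def Int_def)
    ultimately show ?thesis by simp
  qed
  finally show ?thesis unfolding \<tau>_def by (simp only: mult_minus1)
qed

lemma schur_prod_permutes:
  assumes "finite S" "w permutes S"
  shows "schur_prod (x \<circ> w) S = of_int (sign w) * schur_prod x S"
  using assms
proof (induction arbitrary: x rule: permutes_rev_induct)
  case (swap a b p)
  have "permutation p" using swap assms(1) permutation_permutes by blast
  moreover have "schur_prod (y \<circ> Transposition.transpose a b) S = - schur_prod y S" for y :: "nat \<Rightarrow> 'a"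
    using schur_prod_transpose[OF assms(1), of a b y] schur_prod_transpose[OF assms(1), of b a y] swap(1-3)
    by (cases a b rule: linorder_cases) (auto simp: transpose_commute)
  moreover have "x \<circ> (p \<circ> Transposition.transpose a b) = x \<circ> p \<circ> Transposition.transpose a b"
    by (simp add: o_assoc)
  moreover have "sign (p \<circ> Transposition.transpose a b) = - sign p"
    using \<open>permutation p\<close> swap(3) by (simp add: sign_compose permutation_swap_id sign_swap_id)
  ultimately show ?case
    using swap.IH[of x] by (simp only: of_int_minus mult_minus_left)
qed simp

section \<open>Expansion along an index\<close>

text \<open>Distinct variables without reciprocal pairs make all factors of Schur non-zero; the
  excluded values 0, 1 and \<open>- 1\<close> are those excluded in
  \<open>interpolation_identity\<close>. The condition passes to subsets and is invariant under
  permutations.\<close>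

definition generic :: "(nat \<Rightarrow> 'a :: field_char_0) \<Rightarrow> nat set \<Rightarrow> bool" where
  "generic x U \<longleftrightarrow> inj_on x U \<and> (\<forall>i\<in>U. x i \<noteq> 0 \<and> x i \<noteq> 1 \<and> x i \<noteq> - 1) \<and>
     (\<forall>i\<in>U. \<forall>j\<in>U. i \<noteq> j \<longrightarrow> x i * x j \<noteq> 1)"

lemma generic_subset: "generic x U \<Longrightarrow> S \<subseteq> U \<Longrightarrow> generic x S"
  unfolding generic_def by (meson inj_on_subset subsetD)

lemma generic_permutes:
  assumes "generic x U" "w permutes U"
  shows "generic (x \<circ> w) U"
proof -
  have "inj_on (x \<circ> w) U"
    using assms permutes_image[OF assms(2)] permutes_inj[OF assms(2)]
    by (intro comp_inj_on) (auto simp: generic_def intro: inj_on_subset)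
  then show ?thesis
    using assms unfolding generic_def
    by (auto simp: permutes_in_image inj_eq[OF permutes_inj[OF assms(2)]])
qed

lemma schur_factor_nonzero:
  assumes "generic x U" "i \<in> U" "j \<in> U" "i \<noteq> j"
  shows "schur_factor x i j \<noteq> 0"
  using assms by (auto simp: schur_factor_def generic_def dest: inj_onD)

text \<open>Interpolation at \<open>t = 1\<close>, divided by the product of the
  \<open>x i - 1\<close>. The sign changes from \<open>1 - x i\<close> to \<open>x i - 1\<close>
  cancel because \<open>J - {j}\<close> has even size.\<close>

lemma sum_inverse_schur_factor:
  fixes x :: "nat \<Rightarrow> 'a :: field_char_0"
  assumes fin: "finite J" and odd: "odd (card J)" and gen: "generic x J"
  shows "(\<Sum>j\<in>J. \<Prod>i\<in>J-{j}. 1 / schur_factor x i j) = 1"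
proof -
  have ne: "(\<Prod>i\<in>J. x i - 1) \<noteq> 0"
    using fin gen by (auto simp: generic_def)
  have "(\<Prod>i\<in>J. x i - 1) =
    (\<Sum>j\<in>J. (\<Prod>i\<in>J-{j}. (1 - x i * x j) / (x i - x j)) * ((x j - 1) * (\<Prod>i\<in>J-{j}. 1 - x i * 1)))"
    using gen by (intro interpolation_identity fin odd) (auto simp: generic_def)
  also have "\<dots> = (\<Sum>j\<in>J. (\<Prod>i\<in>J-{j}. 1 / schur_factor x i j) * (\<Prod>i\<in>J. x i - 1))"
  proof (rule sum.cong[OF refl])
    fix j assume j: "j \<in> J"
    have "(\<Prod>i\<in>J-{j}. 1 - x i * 1) = (\<Prod>i\<in>J-{j}. (- 1) * (x i - 1))"
      by simp
    also have "\<dots> = (- 1) ^ card (J - {j}) * (\<Prod>i\<in>J-{j}. x i - 1)"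
      unfolding prod.distrib by simp
    also have "even (card (J - {j}))"
      using j odd fin by simp
    then have "(- 1 :: 'a) ^ card (J - {j}) = 1" by simp
    finally have "(x j - 1) * (\<Prod>i\<in>J-{j}. 1 - x i * 1) = (\<Prod>i\<in>J. x i - 1)"
      using j fin by (simp add: prod.remove)
    then show "(\<Prod>i\<in>J-{j}. (1 - x i * x j) / (x i - x j)) * ((x j - 1) * (\<Prod>i\<in>J-{j}. 1 - x i * 1)) =
      (\<Prod>i\<in>J-{j}. 1 / schur_factor x i j) * (\<Prod>i\<in>J. x i - 1)"
      by (simp add: schur_factor_def)
  qed
  finally show ?thesis
    using ne unfolding sum_distrib_right[symmetric] by simp
qed

text \<open>Interpolation at \<open>t = x m\<close>, divided by the product of the
  \<open>x i - x m\<close>. The summand is the reciprocal of all factors linking \<open>m\<close> or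
  its partner \<open>j\<close> to a third index.\<close>

lemma sum_inverse_schur_factor_pair:
  fixes x :: "nat \<Rightarrow> 'a :: field_char_0"
  assumes fin: "finite J" and odd: "odd (card J)" and gen: "generic x (insert m J)" and m: "m \<notin> J"
  shows "(\<Sum>j\<in>J. \<Prod>i\<in>J-{j}. 1 / (schur_factor x m i * schur_factor x j i)) = 1"
proof -
  have xm: "x i - x m \<noteq> 0" if "i \<in> J" for i
    using gen m that by (auto simp: generic_def inj_on_def)
  have ne: "(\<Prod>i\<in>J. x i - x m) \<noteq> 0"
    using fin xm by simp
  have "(\<Prod>i\<in>J. x i - x m) =
    (\<Sum>j\<in>J. (\<Prod>i\<in>J-{j}. (1 - x i * x j) / (x i - x j)) * ((x j - x m) * (\<Prod>i\<in>J-{j}. 1 - x i * x m)))"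
    using gen by (intro interpolation_identity fin odd) (auto simp: generic_def)
  also have "\<dots> = (\<Sum>j\<in>J. (\<Prod>i\<in>J-{j}. 1 / (schur_factor x m i * schur_factor x j i)) * (\<Prod>i\<in>J. x i - x m))"
  proof (rule sum.cong[OF refl])
    fix j assume j: "j \<in> J"
    have "(\<Prod>i\<in>J-{j}. (1 - x i * x j) / (x i - x j)) * (\<Prod>i\<in>J-{j}. 1 - x i * x m) =
      (\<Prod>i\<in>J-{j}. 1 / (schur_factor x m i * schur_factor x j i)) * (\<Prod>i\<in>J-{j}. x i - x m)"
      unfolding prod.distrib[symmetric]
    proof (rule prod.cong[OF refl])
      fix i assume i: "i \<in> J - {j}"
      \<comment> \<open>Two swaps, so the signs cancel.\<close>
      have "schur_factor x m i * schur_factor x j i = schur_factor x i m * schur_factor x i j"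
        using schur_factor_swap[of x m i] schur_factor_swap[of x j i] by simp
      then show "(1 - x i * x j) / (x i - x j) * (1 - x i * x m) =
          1 / (schur_factor x m i * schur_factor x j i) * (x i - x m)"
        using xm[of i] i by (simp add: schur_factor_def)
    qed
    then show "(\<Prod>i\<in>J-{j}. (1 - x i * x j) / (x i - x j)) * ((x j - x m) * (\<Prod>i\<in>J-{j}. 1 - x i * x m)) =
      (\<Prod>i\<in>J-{j}. 1 / (schur_factor x m i * schur_factor x j i)) * (\<Prod>i\<in>J. x i - x m)"
      using j fin by (simp add: prod.remove mult_ac)
  qed
  finally show ?thesis
    using ne unfolding sum_distrib_right[symmetric] by simp
qed

text \<open>By antisymmetry the summand for \<open>j\<close> is the full product divided by the
  factors that involve \<open>j\<close>, and these reciprocals add up to 1. Expressing the removal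
  of \<open>j\<close> by a transposition keeps the index set \<open>T\<close> fixed, the form that
  \<open>alternate_permute\<close> handles.\<close>

lemma schur_prod_expand_odd:
  fixes x :: "nat \<Rightarrow> 'a :: field_char_0"
  assumes fin: "finite T" and even: "even (card T)" and less: "\<And>i. i \<in> T \<Longrightarrow> i < n"
    and gen: "generic x (insert n T)"
  shows "schur_prod x (insert n T) =
    (\<Sum>j\<in>insert n T. of_int (sign (Transposition.transpose n j)) *
      schur_prod (x \<circ> Transposition.transpose n j) T)"
proof -
  define J where "J = insert n T"
  have n: "n \<notin> T" using less by blast
  have finJ: "finite J" and cardJ: "odd (card J)"
    using fin even n by (simp_all add: J_def)
  have genJ: "generic x J" using gen by (simp add: J_def)
  have summand: "of_int (sign (Transposition.transpose n j)) * schur_prod (x \<circ> Transposition.transpose n j) T =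
      schur_prod x J * (\<Prod>i\<in>J-{j}. 1 / schur_factor x i j)" if j: "j \<in> J" for j
  proof -
    define \<sigma> where "\<sigma> = Transposition.transpose n j"
    have \<sigma>: "\<sigma> permutes J" using j by (auto simp: \<sigma>_def J_def intro: permutes_swap_id)
    \<comment> \<open>\<open>\<sigma>\<close> maps \<open>T\<close> onto \<open>J - {j}\<close> and
      \<open>n\<close> to \<open>j\<close>.\<close>
    have "(\<Prod>i\<in>T. schur_factor (x \<circ> \<sigma>) i n) = (\<Prod>i\<in>J-{j}. schur_factor x i j)"
      by (rule prod.reindex_bij_witness[of _ \<sigma> \<sigma>])
         (use j n in \<open>auto simp: \<sigma>_def J_def Transposition.transpose_def schur_factor_def split: if_splits\<close>)
    then have "of_int (sign \<sigma>) * schur_prod x J =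
        (\<Prod>i\<in>J-{j}. schur_factor x i j) * schur_prod (x \<circ> \<sigma>) T"
      using schur_prod_insert_greater[OF fin less, of "x \<circ> \<sigma>"] schur_prod_permutes[OF finJ \<sigma>, of x]
      by (simp add: J_def)
    moreover have "(\<Prod>i\<in>J-{j}. schur_factor x i j) \<noteq> 0"
      using finJ schur_factor_nonzero[OF genJ _ j] by simp
    ultimately have "schur_prod (x \<circ> \<sigma>) T =
        of_int (sign \<sigma>) * schur_prod x J * (\<Prod>i\<in>J-{j}. 1 / schur_factor x i j)"
      by (simp add: prod_dividef field_simps)
    then show ?thesis
      unfolding \<sigma>_def[symmetric] by (simp add: mult.assoc[symmetric] flip: of_int_mult)
  qed
  have "(\<Sum>j\<in>J. of_int (sign (Transposition.transpose n j)) * schur_prod (x \<circ> Transposition.transpose n j) T)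
      = schur_prod x J * (\<Sum>j\<in>J. \<Prod>i\<in>J-{j}. 1 / schur_factor x i j)"
    unfolding sum_distrib_left by (rule sum.cong[OF refl summand])
  then show ?thesis
    using sum_inverse_schur_factor[OF finJ cardJ genJ] by (simp add: J_def)
qed

text \<open>As in the odd case, but with \<open>m\<close> fixed and \<open>j\<close> running over
  its possible partners: dividing out the factors that link \<open>m\<close> or \<open>j\<close> to
  a third index leaves the factor of the pair and the product over the remaining indices.\<close>

lemma schur_prod_expand_even:
  fixes x :: "nat \<Rightarrow> 'a :: field_char_0"
  assumes fin: "finite T" and even: "even (card T)" and less: "m < k" "\<And>i. i \<in> T \<Longrightarrow> k < i"
    and gen: "generic x (insert m (insert k T))"
  shows "schur_prod x (insert m (insert k T)) =
    (\<Sum>j\<in>insert k T. of_int (sign (Transposition.transpose k j)) *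
      (schur_factor (x \<circ> Transposition.transpose k j) m k * schur_prod (x \<circ> Transposition.transpose k j) T))"
proof -
  define J where "J = insert k T"
  have k: "k \<notin> T" using less by blast
  have finJ: "finite J" and cardJ: "odd (card J)"
    using fin even k by (simp_all add: J_def)
  have genJ: "generic x (insert m J)" using gen by (simp add: J_def)
  have mJ: "m < i" if "i \<in> J" for i using that less by (auto simp: J_def intro: order.strict_trans)
  then have m: "m \<notin> J" by blast
  have summand: "of_int (sign (Transposition.transpose k j)) *
      (schur_factor (x \<circ> Transposition.transpose k j) m k * schur_prod (x \<circ> Transposition.transpose k j) T) =
      schur_prod x (insert m J) * (\<Prod>i\<in>J-{j}. 1 / (schur_factor x m i * schur_factor x j i))" if j: "j \<in> J" for j
  proof -
    define \<sigma> where "\<sigma> = Transposition.transpose k j"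
    have \<sigma>: "\<sigma> permutes insert m J" using j by (auto simp: \<sigma>_def J_def intro: permutes_swap_id)
    have \<sigma>m: "\<sigma> m = m" using m j by (auto simp: \<sigma>_def J_def Transposition.transpose_def)
    have \<sigma>k: "\<sigma> k = j" by (simp add: \<sigma>_def)
    have re: "(\<Prod>i\<in>T. f (\<sigma> i)) = (\<Prod>i\<in>J-{j}. f i)" for f :: "nat \<Rightarrow> 'a"
      by (rule prod.reindex_bij_witness[of _ \<sigma> \<sigma>])
         (use j k in \<open>auto simp: \<sigma>_def J_def Transposition.transpose_def split: if_splits\<close>)
    have "(\<Prod>i\<in>T. schur_factor (x \<circ> \<sigma>) m i) = (\<Prod>i\<in>J-{j}. schur_factor x m i)"
      using re[of "schur_factor x m"] by (simp add: schur_factor_def \<sigma>m)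
    moreover have "(\<Prod>i\<in>T. schur_factor (x \<circ> \<sigma>) k i) = (\<Prod>i\<in>J-{j}. schur_factor x j i)"
      using re[of "schur_factor x j"] by (simp add: schur_factor_def \<sigma>k)
    moreover have "schur_prod (x \<circ> \<sigma>) (insert m J) =
        schur_factor (x \<circ> \<sigma>) m k * (\<Prod>i\<in>T. schur_factor (x \<circ> \<sigma>) m i) *
        ((\<Prod>i\<in>T. schur_factor (x \<circ> \<sigma>) k i) * schur_prod (x \<circ> \<sigma>) T)"
      using schur_prod_insert_less[OF finJ mJ, of "x \<circ> \<sigma>"] schur_prod_insert_less[OF fin less(2), of "x \<circ> \<sigma>"] fin k
      by (simp add: J_def)
    ultimately have "of_int (sign \<sigma>) * schur_prod x (insert m J) =
        (\<Prod>i\<in>J-{j}. schur_factor x m i * schur_factor x j i) *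
        (schur_factor (x \<circ> \<sigma>) m k * schur_prod (x \<circ> \<sigma>) T)"
      using schur_prod_permutes[OF _ \<sigma>, of x] finJ by (simp add: prod.distrib mult_ac)
    moreover have "(\<Prod>i\<in>J-{j}. schur_factor x m i * schur_factor x j i) \<noteq> 0"
    proof -
      have "schur_factor x m i \<noteq> 0" "schur_factor x j i \<noteq> 0" if "i \<in> J - {j}" for i
        using schur_factor_nonzero[OF genJ, of m i] schur_factor_nonzero[OF genJ, of j i] that j m by auto
      then show ?thesis using finJ by simp
    qed
    ultimately have "schur_factor (x \<circ> \<sigma>) m k * schur_prod (x \<circ> \<sigma>) T =
        of_int (sign \<sigma>) * schur_prod x (insert m J) * (\<Prod>i\<in>J-{j}. 1 / (schur_factor x m i * schur_factor x j i))"
      unfolding prod_dividef by (simp add: field_simps)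
    then show ?thesis
      unfolding \<sigma>_def[symmetric] by (simp add: mult.assoc[symmetric] flip: of_int_mult)
  qed
  have "(\<Sum>j\<in>J. of_int (sign (Transposition.transpose k j)) *
      (schur_factor (x \<circ> Transposition.transpose k j) m k * schur_prod (x \<circ> Transposition.transpose k j) T))
      = schur_prod x (insert m J) * (\<Sum>j\<in>J. \<Prod>i\<in>J-{j}. 1 / (schur_factor x m i * schur_factor x j i))"
    unfolding sum_distrib_left by (rule sum.cong[OF refl summand])
  then show ?thesis
    using sum_inverse_schur_factor_pair[OF finJ cardJ genJ m] by (simp add: J_def)
qed

section \<open>Alternating sums\<close>

text \<open>Antisymmetrization. The argument \<open>g\<close> is a function of the whole family of
  variables, so that a permutation acts by precomposition; on exponentials this is the Weyl group
  action, see \<open>weyl_act_pair_prod\<close>.\<close>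

definition alternate :: "nat set \<Rightarrow> ((nat \<Rightarrow> 'a) \<Rightarrow> 'a) \<Rightarrow> (nat \<Rightarrow> 'a) \<Rightarrow> 'a :: field_char_0" where
  "alternate U g x = (\<Sum>w | w permutes U. of_int (sign w) * g (x \<circ> w))"

text \<open>Reindexing the sum by \<open>w \<circ> \<sigma>\<close> absorbs the sign. Hence all
  terms of an expansion by signed transpositions contribute equally.\<close>

lemma alternate_permute:
  assumes "finite U" "\<sigma> permutes U"
  shows "alternate U (\<lambda>y. of_int (sign \<sigma>) * g (y \<circ> \<sigma>)) x = alternate U g x"
proof -
  have "alternate U g x = (\<Sum>w | w permutes U. of_int (sign (w \<circ> \<sigma>)) * g (x \<circ> (w \<circ> \<sigma>)))"
    unfolding alternate_def by (rule sum_permutations_compose_right[OF assms(2)])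
  also have "\<dots> = alternate U (\<lambda>y. of_int (sign \<sigma>) * g (y \<circ> \<sigma>)) x"
    unfolding alternate_def
  proof (rule sum.cong[OF refl])
    fix w assume "w \<in> {w. w permutes U}"
    then have "sign (w \<circ> \<sigma>) = sign w * sign \<sigma>"
      using assms by (simp add: sign_compose permutation_permutes[THEN iffD2] exI[of _ U])
    then show "of_int (sign (w \<circ> \<sigma>)) * g (x \<circ> (w \<circ> \<sigma>)) =
        of_int (sign w) * (of_int (sign \<sigma>) * g (x \<circ> w \<circ> \<sigma>))"
      by (simp add: o_assoc mult.assoc)
  qed
  finally show ?thesis by simp
qed

text \<open>Allows the expansions, which hold for generic variables only, to be used under
  \<open>alternate\<close>: permuted generic variables are again generic.\<close>

lemma alternate_cong:
  assumes "generic x U" "\<And>y. generic y U \<Longrightarrow> g y = h y"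
  shows "alternate U g x = alternate U h x"
  unfolding alternate_def using assms generic_permutes by (intro sum.cong) auto

lemma alternate_sum:
  "alternate U (\<lambda>y. \<Sum>j\<in>J. g j y) x = (\<Sum>j\<in>J. alternate U (g j) x)"
  unfolding alternate_def sum_distrib_left by (rule sum.swap)

lemma alternate_add: "alternate U (\<lambda>y. g y + h y) x = alternate U g x + alternate U h x"
  by (simp add: alternate_def algebra_simps sum.distrib)

lemma alternate_schur_prod:
  assumes "finite U"
  shows "alternate U (\<lambda>y. schur_prod y U) x = of_nat (fact (card U)) * schur_prod x U"
proof -
  have "alternate U (\<lambda>y. schur_prod y U) x = (\<Sum>w | w permutes U. schur_prod x U)"
    unfolding alternate_def using assms
    by (intro sum.cong) (auto simp: schur_prod_permutes mult.assoc[symmetric] simp flip: of_int_mult)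
  then show ?thesis
    using card_permutations[OF refl assms] by simp
qed

text \<open>For \<open>k = n div 2\<close> and \<open>x i = fexp (\<epsilon> i)\<close> this is the
  fraction inside the Weyl group sum. It keeps the first half of each antisymmetric factor
  \<open>(a - b) / (1 - a * b)\<close>.\<close>

definition pair_prod :: "nat \<Rightarrow> (nat \<Rightarrow> 'a) \<Rightarrow> 'a :: field" where
  "pair_prod k x = (\<Prod>i\<in>{1..k}. x (2 * i - 1) / (1 - x (2 * i - 1) * x (2 * i)))"

text \<open>With \<open>k\<close> pairs already split off, the next index \<open>2 * k + 1\<close>
  has \<open>2 * (r - k) - 1\<close> possible partners, and the two halves of the factor of the new
  pair double this number.\<close>

lemma alternate_pair_step:
  fixes x :: "nat \<Rightarrow> 'a :: field_char_0"
  assumes fin: "finite U" and U: "{1..2 * r} \<subseteq> U" and gen: "generic x U" and k: "k < r"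
  shows "alternate U (\<lambda>y. pair_prod k y * schur_prod y {2 * k + 1..2 * r}) x =
    of_nat (4 * (r - k) - 2) * alternate U (\<lambda>y. pair_prod (Suc k) y * schur_prod y {2 * Suc k + 1..2 * r}) x"
    (is "alternate U ?G x = _ * alternate U ?G' x")
proof -
  define m where "m = 2 * k + 1"
  define l where "l = 2 * k + 2"
  define T where "T = {2 * Suc k + 1..2 * r}"
  define s where "s j = Transposition.transpose l j" for j
  \<comment> \<open>The term of the expansion in which \<open>m\<close> is paired with its successor
    \<open>l\<close>.\<close>
  define H where "H y = pair_prod k y * (schur_factor y m l * schur_prod y T)" for y :: "nat \<Rightarrow> 'a"
  have set: "{2 * k + 1..2 * r} = insert m (insert l T)"
    using k by (auto simp: m_def l_def T_def)
  have T: "finite T" "even (card T)" "\<And>i. i \<in> T \<Longrightarrow> l < i" "l \<notin> T"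
    by (auto simp: T_def l_def)
  have ml: "m < l" by (simp add: m_def l_def)
  have sub: "insert m (insert l T) \<subseteq> U"
    using U unfolding set[symmetric] by auto
  have s: "s j permutes U" if "j \<in> insert l T" for j
    using that sub by (auto simp: s_def intro: permutes_swap_id)
  \<comment> \<open>Transpositions of indices above \<open>2 * k\<close> do not touch the pairs
    already split off.\<close>
  have pp: "pair_prod k (y \<circ> Transposition.transpose a b) = pair_prod k y"
    if "a > 2 * k" "b > 2 * k" for y :: "nat \<Rightarrow> 'a" and a b
    unfolding pair_prod_def using that
    by (intro prod.cong) (auto simp: Transposition.transpose_def)
  have G: "?G y = (\<Sum>j\<in>insert l T. of_int (sign (s j)) * H (y \<circ> s j))" if "generic y U" for y
  proof -
    have "schur_prod y (insert m (insert l T)) = (\<Sum>j\<in>insert l T. of_int (sign (s j)) *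
        (schur_factor (y \<circ> s j) m l * schur_prod (y \<circ> s j) T))"
      unfolding s_def using generic_subset[OF that sub] T ml by (intro schur_prod_expand_even) auto
    moreover have "pair_prod k y = pair_prod k (y \<circ> s j)" if "j \<in> insert l T" for j
      using that unfolding s_def by (subst pp) (auto simp: l_def T_def)
    ultimately show ?thesis
      unfolding set by (simp add: sum_distrib_left H_def mult_ac)
  qed
  have tau: "Transposition.transpose m l permutes U" "sign (Transposition.transpose m l) = - 1"
    using sub ml by (auto intro: permutes_swap_id simp: sign_swap_id)
  \<comment> \<open>The subtracted half of the factor for \<open>m\<close> and \<open>l\<close> is
    the first half with \<open>m\<close> and \<open>l\<close> exchanged.\<close>
  have H: "H y = ?G' y + of_int (sign (Transposition.transpose m l)) * ?G' (y \<circ> Transposition.transpose m l)"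
    for y
  proof -
    have Suc: "pair_prod (Suc k) z = pair_prod k z * (z m / (1 - z m * z l))" for z :: "nat \<Rightarrow> 'a"
      by (simp add: pair_prod_def m_def l_def)
    have "schur_prod (y \<circ> Transposition.transpose m l) T = schur_prod y T"
      unfolding schur_prod_def
      by (rule prod.cong) (auto simp: ordered_pairs_def schur_factor_def T_def m_def l_def Transposition.transpose_def)
    moreover have "pair_prod k (y \<circ> Transposition.transpose m l) = pair_prod k y"
      by (rule pp) (auto simp: m_def l_def)
    ultimately show ?thesis
      unfolding tau(2) H_def Suc T_def[symmetric]
      by (simp add: schur_factor_def diff_divide_distrib algebra_simps)
  qed
  have "alternate U ?G x = alternate U (\<lambda>y. \<Sum>j\<in>insert l T. of_int (sign (s j)) * H (y \<circ> s j)) x"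
    by (rule alternate_cong[OF gen G])
  also have "\<dots> = (\<Sum>j\<in>insert l T. alternate U H x)"
    unfolding alternate_sum by (intro sum.cong refl alternate_permute fin s)
  also have "\<dots> = of_nat (card (insert l T)) * alternate U H x"
    by simp
  also have "alternate U H x = 2 * alternate U ?G' x"
    unfolding H alternate_add using alternate_permute[OF fin tau(1), of ?G' x] by simp
  also have "card (insert l T) = 2 * (r - k) - 1"
    using k T by (simp add: T_def)
  also have "of_nat (2 * (r - k) - 1) * (2 * alternate U ?G' x) = of_nat (4 * (r - k) - 2) * alternate U ?G' x"
    using k by (simp add: of_nat_diff algebra_simps)
  finally show ?thesis .
qed

text \<open>Iterates the step, by induction on the number \<open>i\<close> of pairs still to be
  split off. \<open>U\<close> may be larger than \<open>{1..2 * r}\<close>, which covers odd rank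
  with its unpaired index.\<close>

lemma alternate_pair_prod:
  fixes x :: "nat \<Rightarrow> 'a :: field_char_0"
  assumes fin: "finite U" and U: "{1..2 * r} \<subseteq> U" and gen: "generic x U"
  shows "of_nat (fact r) * alternate U (\<lambda>y. schur_prod y {1..2 * r}) x =
    of_nat (fact (2 * r)) * alternate U (pair_prod r) x"
proof -
  let ?G = "\<lambda>k y. pair_prod k y * schur_prod y {2 * k + 1..2 * r}"
  have "of_nat (fact i) * alternate U (?G (r - i)) x = of_nat (fact (2 * i)) * alternate U (?G r) x"
    if "i \<le> r" for i
    using that
  proof (induction i)
    case (Suc i)
    have e: "Suc (r - Suc i) = r - i" "r - (r - Suc i) = Suc i" using Suc.prems by auto
    have "of_nat (fact (Suc i)) * alternate U (?G (r - Suc i)) x =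
      of_nat (Suc i) * of_nat (4 * Suc i - 2) * (of_nat (fact i) * alternate U (?G (r - i)) x)"
      using alternate_pair_step[OF fin U gen, of "r - Suc i"] Suc.prems unfolding e by (simp add: algebra_simps)
    also have "\<dots> = of_nat (Suc i * (4 * Suc i - 2) * fact (2 * i)) * alternate U (?G r) x"
      using Suc by (simp add: algebra_simps)
    \<comment> \<open>Here \<open>(i + 1) * (4 * i + 2) = (2 * i + 1) * (2 * i + 2)\<close>.\<close>
    also have "Suc i * (4 * Suc i - 2) * fact (2 * i) = fact (2 * Suc i)"
      by (simp add: algebra_simps)
    finally show ?case .
  qed simp
  \<comment> \<open>For \<open>i = r\<close> no pair is split off on the left and all are on the
    right, so one factor on each side is an empty product.\<close>
  from this[of r] show ?thesis
    by (simp add: pair_prod_def[of 0] schur_prod_def[of _ "{}"] ordered_pairs_def[of "{}"])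
qed

text \<open>The product is alternating, so \<open>n\<close>! times it is its own alternating sum, to
  which the expansions apply.\<close>

lemma schur_prod_eq_alternate:
  fixes x :: "nat \<Rightarrow> 'a :: field_char_0"
  assumes gen: "generic x {1..n}"
  shows "schur_prod x {1..n} = 1 / of_nat (fact (n div 2)) * alternate {1..n} (pair_prod (n div 2)) x"
proof -
  define r where "r = n div 2"
  have "of_nat (fact n) * schur_prod x {1..n} =
      of_nat (if even n then 1 else n) * alternate {1..n} (\<lambda>y. schur_prod y {1..2 * r}) x"
  proof (cases "even n")
    case True
    then show ?thesis using alternate_schur_prod[of "{1..n}" x] by (simp add: r_def)
  next
    case False
    then have n: "{1..n} = insert n {1..2 * r}" unfolding r_def by (auto elim!: oddE)
    have "of_nat (fact n) * schur_prod x {1..n} = alternate {1..n} (\<lambda>y. schur_prod y {1..n}) x"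
      using alternate_schur_prod[of "{1..n}" x] by simp
    also have "\<dots> = alternate {1..n} (\<lambda>y. \<Sum>j\<in>{1..n}. of_int (sign (Transposition.transpose n j)) *
        schur_prod (y \<circ> Transposition.transpose n j) {1..2 * r}) x"
    proof (rule alternate_cong[OF gen])
      fix y :: "nat \<Rightarrow> 'a" assume "generic y {1..n}"
      then show "schur_prod y {1..n} = (\<Sum>j\<in>{1..n}. of_int (sign (Transposition.transpose n j)) *
        schur_prod (y \<circ> Transposition.transpose n j) {1..2 * r})"
        unfolding n using False by (intro schur_prod_expand_odd) (auto simp: r_def elim!: oddE)
    qed
    also have "\<dots> = (\<Sum>j\<in>{1..n}. alternate {1..n} (\<lambda>y. schur_prod y {1..2 * r}) x)"
      unfolding alternate_sum using False
      by (intro sum.cong refl alternate_permute permutes_swap_id) (auto elim: oddE)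
    finally show ?thesis using False by simp
  qed
  then have "of_nat (fact n) * (of_nat (fact r) * schur_prod x {1..n}) =
      of_nat (if even n then 1 else n) * (of_nat (fact (2 * r)) * alternate {1..n} (pair_prod r) x)"
    unfolding mult.left_commute[of "of_nat (fact n)"]
    using alternate_pair_prod[OF _ _ gen, of r] by (simp add: r_def mult.left_commute)
  also have "\<dots> = of_nat ((if even n then 1 else n) * fact (2 * r)) * alternate {1..n} (pair_prod r) x"
    by simp
  also have "(if even n then 1 else n) * fact (2 * r) = fact n"
    by (auto simp: r_def elim!: oddE)
  finally have "of_nat (fact r) * schur_prod x {1..n} = alternate {1..n} (pair_prod r) x"
    by simp
  then show ?thesis by (simp add: r_def field_simps)
qed

section \<open>Formal exponentials\<close>

text \<open>Makes the identities above, proved over \<open>field_char_0\<close>, available in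
  \<open>exp_field\<close>.\<close>

instance fract :: ("{idom, ring_char_0}") field_char_0
proof
  have "of_nat n = Fraction_Field.Fract (of_nat n :: 'a) 1" for n
    by (induction n) (simp_all add: Zero_fract_def One_fract_def)
  then show "inj (of_nat :: nat \<Rightarrow> 'a fract)"
    by (auto simp: inj_def eq_fract)
qed

lemma fexp_inject: "fexp x = fexp y \<longleftrightarrow> x = y"
  by (auto simp: fexp_def eq_fract dest: arg_cong[of _ _ "\<lambda>a. Poly_Mapping.lookup a x"]
      simp: lookup_single when_def split: if_splits)

text \<open>Compares coefficients at \<open>x\<close>: 1 on one side, \<open>- 1\<close> or 0 on the
  other.\<close>

lemma fexp_ne_minus_1: "fexp x \<noteq> - 1"
proof
  assume "fexp x = - 1"
  then have "Poly_Mapping.single x 1 = (- 1 :: group_algebra)"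
    by (simp add: fexp_def One_fract_def eq_fract)
  then have "Poly_Mapping.lookup (Poly_Mapping.single x 1) x =
      Poly_Mapping.lookup (- Poly_Mapping.single 0 1 :: group_algebra) x"
    by simp
  then have "(1 :: complex) = - (1 when 0 = x)"
    by (simp only: lookup_single lookup_uminus) simp
  then show False
    by (cases "0 = x") simp_all
qed

lemma fexp_nonzero: "fexp x \<noteq> 0"
  using fexp_add[of x "- x"] by (auto simp: fexp_0)

lemma fexp_sum: "finite A \<Longrightarrow> fexp (sum f A) = (\<Prod>a\<in>A. fexp (f a))"
  by (induction rule: finite_induct) (simp_all add: fexp_0 fexp_add)

lemma eps_ne_0: "\<epsilon> i \<noteq> 0"
proof
  assume "\<epsilon> i = 0"
  then have "coord (\<epsilon> i) i = coord 0 i" by simp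
  then show False by simp
qed

lemma generic_fexp: "generic (\<lambda>i. fexp (\<epsilon> i)) U"
proof -
  have "fexp (\<epsilon> i) \<noteq> 1" for i
    by (metis eps_ne_0 fexp_0 fexp_inject)
  moreover have "fexp (\<epsilon> i) * fexp (\<epsilon> j) \<noteq> 1" for i j
    by (metis eps_ne(1) fexp_0 fexp_add fexp_inject)
  ultimately show ?thesis
    unfolding generic_def inj_on_def
    by (auto simp: fexp_inject fexp_nonzero fexp_ne_minus_1 dest: eps_ne(2))
qed

section \<open>Translation of both sides into products in the variables\<close>

text \<open>Repeated addition is what \<open>fexp_sum\<close> can turn into a product.\<close>

lemma of_nat_scale: "of_nat n *\<^sub>w x = (\<Sum>j<n. x)"
  by (rule weight_eqI) simp

text \<open>The coefficient \<open>n - i\<close> is the number of pairs with first entry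
  \<open>i\<close>, so every pair receives one factor.\<close>

lemma fexp_rho: "fexp (rho n) = (\<Prod>(i, j)\<in>ordered_pairs {1..n}. fexp (\<epsilon> i))"
proof -
  have "ordered_pairs {1..n} = (SIGMA i:{1..n}. {i<..n})"
    by (auto simp: ordered_pairs_def)
  then have "(\<Prod>(i, j)\<in>ordered_pairs {1..n}. fexp (\<epsilon> i)) = (\<Prod>i=1..n. \<Prod>j\<in>{i<..n}. fexp (\<epsilon> i))"
    by (subst prod.Sigma) simp_all
  also have "\<dots> = fexp (rho n)"
    unfolding rho_def of_nat_scale by (simp add: fexp_sum)
  finally show ?thesis by simp
qed

text \<open>In each pair, the factor from \<open>rho n\<close> clears the negative exponent:
  \<open>a * (1 - b / a) = a - b\<close>.\<close>

lemma fexp_rho_denominator: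
  "fexp (rho n) * denominator n = schur_prod (\<lambda>i. fexp (\<epsilon> i)) {1..n}"
proof -
  have P: "{(i, j). 1 \<le> i \<and> i < j \<and> j \<le> n} = ordered_pairs {1..n}"
    by (auto simp: ordered_pairs_def)
  have "fexp (rho n) * denominator n = (\<Prod>p\<in>ordered_pairs {1..n}.
      (case p of (i, j) \<Rightarrow> fexp (\<epsilon> i)) * (case p of (i, j) \<Rightarrow> 1 - fexp (- (\<epsilon> i - \<epsilon> j))) /
      (case p of (i, j) \<Rightarrow> 1 - fexp (\<epsilon> i + \<epsilon> j)))"
    unfolding denominator_eq P fexp_rho prod_dividef prod.distrib by simp
  also have "\<dots> = schur_prod (\<lambda>i. fexp (\<epsilon> i)) {1..n}"
    unfolding schur_prod_def
    by (rule prod.cong)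
       (auto simp: schur_factor_def fexp_add[symmetric] right_diff_distrib)
  finally show ?thesis .
qed

lemma rho_up_eq: "rho_up n = (\<Sum>i=1..n div 2. \<epsilon> (2 * i - 1))"
proof (rule weight_eqI)
  fix c :: nat
  \<comment> \<open>The only index for which \<open>beta k\<close> can involve
    \<open>\<epsilon> c\<close>. Both \<open>c = 0\<close> and, for odd \<open>n\<close>,
    \<open>c = n\<close> give a \<open>k\<close> outside \<open>{1..n div 2}\<close>.\<close>
  define k where "k = (c + 1) div 2"
  have rho: "coord (rho n) c = (if c \<in> {1..n} then of_nat (n - c) else 0)"
    by (simp add: rho_def if_distrib[of "\<lambda>x. _ * x"] sum.delta' cong: if_cong)
  have "coord (\<Sum>i=1..n div 2. of_nat (n - 2 * i) *\<^sub>w beta i) c =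
      (\<Sum>i=1..n div 2. if i = k then - of_nat (n - 2 * k) else 0)"
    unfolding coord_sum by (rule sum.cong) (auto simp: beta_def k_def)
  then have beta: "coord (\<Sum>i=1..n div 2. of_nat (n - 2 * i) *\<^sub>w beta i) c =
      (if k \<in> {1..n div 2} then - of_nat (n - 2 * k) else 0)"
    by simp
  have "coord (\<Sum>i=1..n div 2. \<epsilon> (2 * i - 1)) c = (\<Sum>i=1..n div 2. if i = k then of_bool (odd c) else 0)"
    unfolding coord_sum
  proof (rule sum.cong[OF refl])
    fix i assume "i \<in> {1..n div 2}"
    then have "c = 2 * i - 1 \<longleftrightarrow> i = k \<and> odd c"
      unfolding k_def by simp presburger
    then show "coord (\<epsilon> (2 * i - 1)) c = (if i = k then of_bool (odd c) else 0)"
      by simp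
  qed
  then have up: "coord (\<Sum>i=1..n div 2. \<epsilon> (2 * i - 1)) c = (if k \<in> {1..n div 2} then of_bool (odd c) else 0)"
    by simp
  show "coord (rho_up n) c = coord (\<Sum>i=1..n div 2. \<epsilon> (2 * i - 1)) c"
    unfolding rho_up_def up coord_simps rho beta
    by (cases "even c") (auto simp: k_def of_nat_diff elim!: oddE evenE)
qed

lemma inj_beta: "inj_on beta {1..r}"
proof (rule inj_onI)
  fix i j assume "i \<in> {1..r}" "j \<in> {1..r}" "beta i = beta j"
  moreover from this have "\<epsilon> (2 * i - 1) + \<epsilon> (2 * i) = \<epsilon> (2 * j - 1) + \<epsilon> (2 * j)"
    unfolding beta_def neg_equal_iff_equal by blast
  ultimately show "i = j"
    using pair_eq_of_eps_sum[of "2 * i - 1" "2 * i" "2 * j - 1" "2 * j"] by auto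
qed

lemma fexp_rho_up_quotient:
  "fexp (rho_up n) / (\<Prod>b\<in>beta_set n. 1 - fexp (- b)) = pair_prod (n div 2) (\<lambda>i. fexp (\<epsilon> i))"
  unfolding beta_set_def rho_up_eq prod.reindex[OF inj_beta] pair_prod_def prod_dividef
  by (simp add: fexp_sum beta_def fexp_add mult.commute)

lemma weyl_act_prod: "inj w \<Longrightarrow> weyl_act w (\<Prod>i\<in>A. f i) = (\<Prod>i\<in>A. weyl_act w (f i))"
  by (induction A rule: infinite_finite_induct) (simp_all add: weyl_act_1 weyl_act_mult)

text \<open>The action respects the field operations and sends \<open>fexp (\<epsilon> i)\<close> to
  \<open>fexp (\<epsilon> (w i))\<close>, so it only renames the variables.\<close>

lemma weyl_act_pair_prod:
  assumes "inj w"
  shows "weyl_act w (pair_prod k (\<lambda>i. fexp (\<epsilon> i))) = pair_prod k ((\<lambda>i. fexp (\<epsilon> i)) \<circ> w)"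
proof -
  have "weyl_act w (- 1) + 1 = 0"
    using weyl_act_add[OF assms, of "- 1" 1] assms by (simp add: weyl_act_0 weyl_act_1)
  then have m1: "weyl_act w (- 1) = - 1" by (simp add: add_eq_0_iff2)
  have diff: "weyl_act w (p - q) = weyl_act w p - weyl_act w q" for p q
    using weyl_act_add[OF assms, of p "- 1 * q"] weyl_act_mult[OF assms, of "- 1" q] by (simp add: m1)
  have "weyl_act w (p / q) = weyl_act w p / weyl_act w q" for p q
    by (simp add: divide_inverse weyl_act_mult weyl_act_inverse assms)
  then show ?thesis
    using assms by (simp add: pair_prod_def weyl_act_prod diff weyl_act_mult weyl_act_1)
qed

theorem theorem3p1:
  fixes n :: nat
  assumes "n \<ge> 1"
  shows "rho_up n = (\<Sum>i=1..n div 2. \<epsilon> (2 * i - 1)) \<and>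
    fexp (rho n) * denominator n =
      1 / of_nat (fact (n div 2)) *
      (\<Sum>w | w permutes {1..n}. of_int (sign w) *
         weyl_act w (fexp (rho_up n) / (\<Prod>b\<in>beta_set n. 1 - fexp (- b))))"
proof
  have "(\<Sum>w | w permutes {1..n}. of_int (sign w) *
         weyl_act w (fexp (rho_up n) / (\<Prod>b\<in>beta_set n. 1 - fexp (- b)))) =
      alternate {1..n} (pair_prod (n div 2)) (\<lambda>i. fexp (\<epsilon> i))"
    unfolding alternate_def fexp_rho_up_quotient
    by (intro sum.cong) (auto simp: weyl_act_pair_prod permutes_inj)
  then show "fexp (rho n) * denominator n =
      1 / of_nat (fact (n div 2)) *
      (\<Sum>w | w permutes {1..n}. of_int (sign w) *
         weyl_act w (fexp (rho_up n) / (\<Prod>b\<in>beta_set n. 1 - fexp (- b))))"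
    unfolding fexp_rho_denominator using schur_prod_eq_alternate[OF generic_fexp] by simp
qed (rule rho_up_eq)

end
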